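(* Let $K$ be a field of characteristic two, let $m\ge 0$ be an integer, and let $\lambda=(\lambda_1,\lambda_2)$ be a partition of $r$ with at most two parts such that $\lambda_1-\lambda_2=m$. Then the set of elements $e_{m,g}\in S_K(\lambda)$, where $g$ runs over all integers $g\ge 0$ with $\binom{m+2g}{g}\not\equiv 0 \pmod 2$ and $m+2g\le r$, is a complete set of primitive orthogonal idempotents for the algebra $S_K(\lambda)$.
   Context: Setting. Let $r$ be a natural number and $\lambda=(\lambda_1,\lambda_2)$, $\lambda_1\ge\lambda_2\ge 0$, a partition of $r$. Let $E_{\mathbb Q}$ be a 2-dimensional $\mathbb Q$-vector space; $S_{\mathbb Q}(2,r)=\mathrm{End}_{\mathbb Q\Sigma_r}(E_{\mathbb Q}^{\otimes r})$ is the Schur algebra. The Lie algebra $\mathfrak{gl}_2$ has basis the matrix units $e=e_{12}$, $f=e_{21}$, $H_1=e_{11}$, $H_2=e_{22}$; its action on $E_{\mathbb Q}^{\otimes r}$ gives a surjection $\mathfrak U(\mathfrak{gl}_2)\to S_{\mathbb Q}(2,r)$, and elements are identified with their images. Put $e^{(i)}=e^i/i!$, $f^{(i)}=f^i/i!$. Let $1_\lambda\in S_{\mathbb Q}(2,r)$ be the idempotent projecting onto the $\lambda$-weight space along the other weight spaces (it is the image of $\binom{H_1}{\lambda_1}\binom{H_2}{\lambda_2}$). Put $S_{\mathbb Q}(\lambda)=1_\lambda S_{\mathbb Q}(2,r)1_\lambda$ and $b(i)=1_\lambda f^{(i)}e^{(i)}1_\lambda$ for $i\ge 0$. Then $b(0)$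 is the identity of $S_{\mathbb Q}(\lambda)$ and $b(i)=0$ for $i>\lambda_2$. Let $S_{\mathbb Z}(2,r)$ be the image of the Kostant $\mathbb Z$-form of $\mathfrak U(\mathfrak{gl}_2)$ and $S_{\mathbb Z}(\lambda)=S_{\mathbb Q}(\lambda)\cap S_{\mathbb Z}(2,r)$; it has $\mathbb Z$-basis $b(0),\dots,b(\lambda_2)$. For a field $K$, $S_K(\lambda)=1_\lambda S_K(2,r)1_\lambda\simeq \mathrm{End}_{K\Sigma_r}(M^\lambda)$, where $M^\lambda$ is the permutation module of $\Sigma_r$ on cosets of the Young subgroup $\Sigma_\lambda$; $S_K(\lambda)\simeq S_{\mathbb Z}(\lambda)\otimes_{\mathbb Z}K$, and $b(i)$ also denotes $b(i)\otimes 1_K$. The algebra $S_K(\lambda)$ is commutative. Definition of $e_{m,g}$. For a nonnegative integer $a$ let $a_u$ denote its $u$-th binary digit ($a=\sum_u a_u2^u$). For $g\ge 0$ with $\binom{m+2g}{g}$ odd and $m+2g\le r$ put $$I_{m,g}=\{u: g_u=0,\ (m+2g)_u=1\},\qquad J_{m,g}=\{u: g_u=1,\ (m+2g)_u=1\},$$ $$e_{m,g}=\prod_{u\in J_{m,g}}b(2^u)\prod_{u\in I_{m,g}}(1-b(2^u))\in S_K(\lambda).$$ "Complete set of primitive orthogonal idempotents" means: each element is a primitive idempotent, distinct elements multiply to zero, and the elements sum to the identity. *)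

theory Defs
  imports "HOL-Algebra.Algebra" "HOL-Combinatorics.Permutations"
begin

section \<open>Endomorphisms of the tensor power\<close>

text \<open>
  \<open>E\<close> is the free module on letters 1, 2.  The \<open>r\<close>-fold tensor power of \<open>E\<close> has as basis the
  words of length \<open>r\<close> in these letters, and an endomorphism \<open>M\<close> of it is given by its matrix:
  \<open>M x y\<close> is the coefficient of \<open>x\<close> in the image of \<open>y\<close>.  Entries outside the words of length
  \<open>r\<close> are required to vanish, so that equality of endomorphisms is equality in HOL.
\<close>

definition tensor_words :: "nat \<Rightarrow> nat list set" where
  "tensor_words r = {w. length w = r \<and> set w \<subseteq> {1, 2}}"

type_synonym 'k endo = "nat list \<Rightarrow> nat list \<Rightarrow> 'k"

definition tensor_End :: "nat \<Rightarrow> 'k::comm_ring_1 endo ring" where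
  "tensor_End r =
     \<lparr> carrier = {M. \<forall>x y. M x y \<noteq> 0 \<longrightarrow> x \<in> tensor_words r \<and> y \<in> tensor_words r},
       monoid.mult = (\<lambda>A B x y. \<Sum>z\<in>tensor_words r. A x z * B z y),
       monoid.one = (\<lambda>x y. if x \<in> tensor_words r \<and> x = y then 1 else 0),
       ring.zero = (\<lambda>x y. 0),
       ring.add = (\<lambda>A B x y. A x y + B x y) \<rparr>"

definition place_perm :: "nat \<Rightarrow> (nat \<Rightarrow> nat) \<Rightarrow> 'k::comm_ring_1 endo" where
  "place_perm r \<sigma> = (\<lambda>x y. if y \<in> tensor_words r \<and> x = permute_list \<sigma> y then 1 else 0)"

definition schur_algebra :: "nat \<Rightarrow> 'k::comm_ring_1 endo ring" where
  "schur_algebra r = (tensor_End r)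
     \<lparr> carrier := {M \<in> carrier (tensor_End r). \<forall>\<sigma>. \<sigma> permutes {..<r} \<longrightarrow>
         M \<otimes>\<^bsub>tensor_End r\<^esub> place_perm r \<sigma> = place_perm r \<sigma> \<otimes>\<^bsub>tensor_End r\<^esub> M} \<rparr>"

definition weight_idem :: "nat \<Rightarrow> nat \<Rightarrow> 'k::comm_ring_1 endo" where
  "weight_idem l1 l2 = (\<lambda>x y. if x \<in> tensor_words (l1 + l2) \<and> x = y \<and>
     count_list x 1 = l1 \<and> count_list x 2 = l2 then 1 else 0)"

definition schur_weight_algebra :: "nat \<Rightarrow> nat \<Rightarrow> 'k::comm_ring_1 endo ring" where
  "schur_weight_algebra l1 l2 = (schur_algebra (l1 + l2))
     \<lparr> carrier := {weight_idem l1 l2 \<otimes>\<^bsub>schur_algebra (l1 + l2)\<^esub> M \<otimes>\<^bsub>schur_algebra (l1 + l2)\<^esub> weight_idem l1 l2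
                   | M. M \<in> carrier (schur_algebra (l1 + l2))},
       one := weight_idem l1 l2 \<rparr>"


section \<open>The action of the Lie algebra and the elements \<open>b(i)\<close>\<close>

definition mat_unit :: "nat \<Rightarrow> nat \<Rightarrow> nat \<Rightarrow> nat \<Rightarrow> 'k::comm_ring_1" where
  "mat_unit i j = (\<lambda>a b. if a = i \<and> b = j then 1 else 0)"

text \<open>\<open>T\<close> acts as the sum over \<open>k\<close> of \<open>1 \<otimes> \<dots> \<otimes> T \<otimes> \<dots> \<otimes> 1\<close> with \<open>T\<close> in position \<open>k\<close>.\<close>

definition gl_action :: "nat \<Rightarrow> (nat \<Rightarrow> nat \<Rightarrow> 'k::comm_ring_1) \<Rightarrow> 'k endo" where
  "gl_action r T = (\<lambda>x y. if x \<in> tensor_words r \<and> y \<in> tensor_words r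
     then \<Sum>k<r. \<Prod>l<r. (if l = k then T (x ! l) (y ! l) else if x ! l = y ! l then 1 else 0)
     else 0)"

definition divided_power :: "nat \<Rightarrow> rat endo \<Rightarrow> nat \<Rightarrow> rat endo" where
  "divided_power r A i = (\<lambda>x y. (A [^]\<^bsub>tensor_End r\<^esub> i) x y / fact i)"

definition b_rat :: "nat \<Rightarrow> nat \<Rightarrow> nat \<Rightarrow> rat endo" where
  "b_rat l1 l2 i =
     weight_idem l1 l2
     \<otimes>\<^bsub>tensor_End (l1 + l2)\<^esub> divided_power (l1 + l2) (gl_action (l1 + l2) (mat_unit 2 1)) i
     \<otimes>\<^bsub>tensor_End (l1 + l2)\<^esub> divided_power (l1 + l2) (gl_action (l1 + l2) (mat_unit 1 2)) i
     \<otimes>\<^bsub>tensor_End (l1 + l2)\<^esub> weight_idem l1 l2"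

text \<open>
  The matrix of \<open>b_rat\<close> is integral (lemma \<open>b_rat_int\<close> below), and \<open>b(i) \<otimes> 1\<^sub>K\<close> is the image of
  this integral matrix under the ring homomorphism from the integers to \<open>K\<close>.
\<close>

definition b_el :: "nat \<Rightarrow> nat \<Rightarrow> nat \<Rightarrow> 'k::comm_ring_1 endo" where
  "b_el l1 l2 i = (\<lambda>x y. of_int \<lfloor>b_rat l1 l2 i x y\<rfloor>)"


section \<open>The elements \<open>e\<^sub>m\<^sub>,\<^sub>g\<close> and primitive idempotents\<close>

definition I_set :: "nat \<Rightarrow> nat \<Rightarrow> nat set" where
  "I_set m g = {u. \<not> bit g u \<and> bit (m + 2 * g) u}"

definition J_set :: "nat \<Rightarrow> nat \<Rightarrow> nat set" where
  "J_set m g = {u. bit g u \<and> bit (m + 2 * g) u}"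

definition e_el :: "nat \<Rightarrow> nat \<Rightarrow> nat \<Rightarrow> nat \<Rightarrow> 'k::comm_ring_1 endo" where
  "e_el l1 l2 m g = (let S = schur_weight_algebra l1 l2 in
     (\<Otimes>\<^bsub>S\<^esub>u\<in>J_set m g. b_el l1 l2 (2 ^ u)) \<otimes>\<^bsub>S\<^esub>
     (\<Otimes>\<^bsub>S\<^esub>u\<in>I_set m g. \<one>\<^bsub>S\<^esub> \<ominus>\<^bsub>S\<^esub> b_el l1 l2 (2 ^ u)))"

definition is_idempotent :: "('a, 'b) ring_scheme \<Rightarrow> 'a \<Rightarrow> bool" where
  "is_idempotent R a \<longleftrightarrow> a \<in> carrier R \<and> a \<otimes>\<^bsub>R\<^esub> a = a"

definition primitive_idempotent :: "('a, 'b) ring_scheme \<Rightarrow> 'a \<Rightarrow> bool" where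
  "primitive_idempotent R a \<longleftrightarrow> is_idempotent R a \<and> a \<noteq> \<zero>\<^bsub>R\<^esub> \<and>
     (\<forall>x y. is_idempotent R x \<longrightarrow> is_idempotent R y \<longrightarrow>
        x \<otimes>\<^bsub>R\<^esub> y = \<zero>\<^bsub>R\<^esub> \<longrightarrow> y \<otimes>\<^bsub>R\<^esub> x = \<zero>\<^bsub>R\<^esub> \<longrightarrow> a = x \<oplus>\<^bsub>R\<^esub> y \<longrightarrow>
        x = \<zero>\<^bsub>R\<^esub> \<or> y = \<zero>\<^bsub>R\<^esub>)"

definition complete_primitive_orthogonal_idempotents ::
    "('a, 'b) ring_scheme \<Rightarrow> 'a set \<Rightarrow> bool" where
  "complete_primitive_orthogonal_idempotents R A \<longleftrightarrow> finite A \<and>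
     (\<forall>a\<in>A. primitive_idempotent R a) \<and>
     (\<forall>a\<in>A. \<forall>b\<in>A. a \<noteq> b \<longrightarrow> a \<otimes>\<^bsub>R\<^esub> b = \<zero>\<^bsub>R\<^esub>) \<and>
     (\<Oplus>\<^bsub>R\<^esub>a\<in>A. a) = \<one>\<^bsub>R\<^esub>"


section \<open>Basic facts\<close>

lemma finite_tensor_words: "finite (tensor_words r)"
proof -
  have "tensor_words r = {w. set w \<subseteq> {1, 2} \<and> length w = r}"
    by (auto simp: tensor_words_def)
  then show ?thesis by (simp add: finite_lists_length_eq)
qed

lemma gl_prod:
  assumes k: "k < r"
  shows "(\<Prod>l<r. (if l = k then mat_unit i j (x ! l) (y ! l)
             else if x ! l = y ! l then 1 else 0)) =
         (if x ! k = i \<and> y ! k = j \<and> (\<forall>l<r. l \<noteq> k \<longrightarrow> x ! l = y ! l)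
          then 1 else (0::'k::comm_ring_1))"
proof (cases "x ! k = i \<and> y ! k = j \<and> (\<forall>l<r. l \<noteq> k \<longrightarrow> x ! l = y ! l)")
  case True
  then show ?thesis by (auto simp: mat_unit_def intro!: prod.neutral)
next
  case False
  then obtain l where "l < r" "(if l = k then mat_unit i j (x ! l) (y ! l)
             else if x ! l = y ! l then 1 else 0) = (0::'k)"
    using k by (auto simp: mat_unit_def split: if_splits)
  then have "(\<Prod>l<r. (if l = k then mat_unit i j (x ! l) (y ! l)
             else if x ! l = y ! l then 1 else 0)) = (0::'k)"
    by (intro prod_zero bexI[of _ l]) simp_all
  with False show ?thesis by simp
qed

text \<open>The Cartan elements act on a word by its number of occurrences of the letter, so
  \<open>weight_idem\<close> projects onto the simultaneous eigenspace for \<open>l1\<close>, \<open>l2\<close>.\<close>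

lemma gl_action_diag:
  "gl_action r (mat_unit i i) x y =
     (if x \<in> tensor_words r \<and> x = y then of_nat (count_list x i) else (0::'k::comm_ring_1))"
proof (cases "x \<in> tensor_words r \<and> y \<in> tensor_words r")
  case True
  then have len: "length x = r" "length y = r" by (auto simp: tensor_words_def)
  have "gl_action r (mat_unit i i) x y =
      (\<Sum>k<r. if x ! k = i \<and> y ! k = i \<and> (\<forall>l<r. l \<noteq> k \<longrightarrow> x ! l = y ! l)
          then 1 else (0::'k))"
    unfolding gl_action_def if_P[OF True] by (intro sum.cong refl gl_prod) simp
  also have "\<dots> = (\<Sum>k<r. if x = y \<and> x ! k = i then 1 else 0)"
    by (intro sum.cong refl if_cong) (use len in \<open>auto simp: list_eq_iff_nth_eq\<close>)
  also have "\<dots> = (if x = y then of_nat (card {k. k < r \<and> x ! k = i}) else 0)"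
    by (auto simp flip: sum.inter_filter simp: lessThan_def)
  also have "card {k. k < r \<and> x ! k = i} = count_list x i"
    by (simp add: count_list_eq_length_filter length_filter_conv_card len eq_commute)
  finally show ?thesis using True by simp
qed (auto simp: gl_action_def)

text \<open>\<open>x\<close> arises from \<open>y\<close> by replacing exactly \<open>n\<close> letters \<open>j\<close> by \<open>i\<close>.\<close>

definition changed :: "nat \<Rightarrow> nat \<Rightarrow> nat \<Rightarrow> nat \<Rightarrow> nat list \<Rightarrow> nat list \<Rightarrow> bool" where
  "changed r i j n x y \<longleftrightarrow> x \<in> tensor_words r \<and> y \<in> tensor_words r \<and>
     (\<forall>k<r. x ! k = y ! k \<or> (x ! k = i \<and> y ! k = j)) \<and> card {k. k < r \<and> x ! k \<noteq> y ! k} = n"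

lemma changed_update:
  assumes ij: "i \<noteq> j" "i \<in> {1, 2}" and y: "y \<in> tensor_words r" and k: "k < r" "y ! k = j"
  shows "changed r i j n x (y[k := i]) \<longleftrightarrow> changed r i j (Suc n) x y \<and> x ! k \<noteq> y ! k"
proof -
  have len: "length y = r" using y by (simp add: tensor_words_def)
  have w: "y[k := i] \<in> tensor_words r"
    using y ij set_update_subset_insert[of y k i] by (auto simp: tensor_words_def)
  show ?thesis
  proof (cases "x ! k = i")
    case True
    have "{l. l < r \<and> x ! l \<noteq> y ! l} = insert k {l. l < r \<and> x ! l \<noteq> y[k := i] ! l}"
      using True k ij len by (auto simp: nth_list_update)
    then have "card {l. l < r \<and> x ! l \<noteq> y ! l} = Suc (card {l. l < r \<and> x ! l \<noteq> y[k := i] ! l})"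
      using True k len by simp
    moreover have "(\<forall>l<r. x ! l = y[k := i] ! l \<or> (x ! l = i \<and> y[k := i] ! l = j)) \<longleftrightarrow>
        (\<forall>l<r. x ! l = y ! l \<or> (x ! l = i \<and> y ! l = j))"
      using True k ij len by (auto simp: nth_list_update)
    ultimately show ?thesis using True k ij w y by (simp add: changed_def)
  next
    case False
    then show ?thesis using k ij len by (auto simp: changed_def nth_list_update)
  qed
qed

lemma gl_action_power:
  assumes ij: "i \<noteq> j" "i \<in> {1, 2}"
  shows "((gl_action r (mat_unit i j) :: 'k::{comm_ring_1,semiring_char_0} endo) [^]\<^bsub>tensor_End r\<^esub> n) x y =
     (if changed r i j n x y then fact n else 0)"
proof (induction n arbitrary: x y)
  case 0
  have "changed r i j 0 x y \<longleftrightarrow> x \<in> tensor_words r \<and> x = y"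
    by (auto simp: changed_def tensor_words_def intro!: nth_equalityI)
  then show ?case by (auto simp: nat_pow_def tensor_End_def)
next
  case (Suc n)
  let ?W = "tensor_words r"
  let ?G = "gl_action r (mat_unit i j) :: 'k endo"
  let ?F = "\<lambda>z. if changed r i j n x z then fact n else (0::'k)"
  have "(?G [^]\<^bsub>tensor_End r\<^esub> Suc n) x y = (\<Sum>z\<in>?W. (?G [^]\<^bsub>tensor_End r\<^esub> n) x z * ?G z y)"
    by (simp add: nat_pow_def tensor_End_def)
  also have "\<dots> = (\<Sum>z\<in>?W. ?F z * ?G z y)"
    by (simp only: Suc.IH)
  also have "\<dots> = (if changed r i j (Suc n) x y then fact (Suc n) else 0)"
  proof (cases "y \<in> ?W")
    case False
    then show ?thesis by (simp add: gl_action_def changed_def)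
  next
    case y: True
    then have len: "length y = r" by (simp add: tensor_words_def)
    have w: "y[k := i] \<in> ?W" for k
      using y ij set_update_subset_insert[of y k i] by (auto simp: tensor_words_def)
    have G: "?G z y = (\<Sum>k<r. if y ! k = j \<and> z = y[k := i] then 1 else 0)" if "z \<in> ?W" for z
    proof -
      have lz: "length z = r" using that by (simp add: tensor_words_def)
      have "(z ! k = i \<and> y ! k = j \<and> (\<forall>l<r. l \<noteq> k \<longrightarrow> z ! l = y ! l)) \<longleftrightarrow>
          (y ! k = j \<and> z = y[k := i])" if "k < r" for k
        using that lz len by (auto simp: nth_list_update list_eq_iff_nth_eq)
      moreover have "?G z y = (\<Sum>k<r. if z ! k = i \<and> y ! k = j \<and> (\<forall>l<r. l \<noteq> k \<longrightarrow> z ! l = y ! l)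
          then 1 else 0)"
        unfolding gl_action_def if_P[OF conjI[OF that y]] by (intro sum.cong refl gl_prod) simp
      ultimately show ?thesis by (auto intro!: sum.cong)
    qed
    have "(\<Sum>z\<in>?W. ?F z * ?G z y) =
        (\<Sum>z\<in>?W. \<Sum>k<r. if y ! k = j \<and> z = y[k := i] then ?F z else 0)"
      by (intro sum.cong refl) (auto simp only: G sum_distrib_left mult_1_right mult_zero_right intro!: sum.cong split: if_splits)
    also have "\<dots> = (\<Sum>k<r. \<Sum>z\<in>?W. if z = y[k := i] then (if y ! k = j then ?F z else 0) else 0)"
      by (subst sum.swap) (intro sum.cong refl, auto)
    also have "\<dots> = (\<Sum>k<r. if y ! k = j then ?F (y[k := i]) else 0)"
      using w by (simp add: sum.delta finite_tensor_words)
    also have "\<dots> = (\<Sum>k<r. if changed r i j (Suc n) x y \<and> x ! k \<noteq> y ! k then fact n else 0)"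
    proof (intro sum.cong refl)
      fix k assume "k \<in> {..<r}"
      then have k: "k < r" by simp
      show "(if y ! k = j then ?F (y[k := i]) else 0) =
          (if changed r i j (Suc n) x y \<and> x ! k \<noteq> y ! k then fact n else 0)"
      proof (cases "y ! k = j")
        case True
        then show ?thesis by (simp add: changed_update[OF ij y k True])
      next
        case False
        then show ?thesis using k by (auto simp: changed_def)
      qed
    qed
    also have "\<dots> = (if changed r i j (Suc n) x y
        then of_nat (card {k. k < r \<and> x ! k \<noteq> y ! k}) * fact n else 0)"
      by (auto simp flip: sum.inter_filter simp: lessThan_def)
    also have "\<dots> = (if changed r i j (Suc n) x y then fact (Suc n) else 0)"
      by (auto simp: changed_def)
    finally show ?thesis .
  qed
  finally show ?case .
qed

lemma divided_power_eq:
  assumes "i \<noteq> j" "i \<in> {1, 2}"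
  shows "divided_power r (gl_action r (mat_unit i j)) n x y = (if changed r i j n x y then 1 else 0)"
  by (simp add: divided_power_def gl_action_power[OF assms])

lemma b_rat_int: "b_rat l1 l2 i x y \<in> \<int>"
proof -
  have d: "divided_power r (gl_action r (mat_unit 2 1)) i x y \<in> \<int>"
          "divided_power r (gl_action r (mat_unit 1 2)) i x y \<in> \<int>" for r x y
    by (simp_all add: divided_power_eq)
  have w: "(weight_idem l1 l2 x y :: rat) \<in> \<int>" for x y
    by (simp add: weight_idem_def)
  show ?thesis
    unfolding b_rat_def tensor_End_def monoid.simps
    by (intro Ints_sum Ints_mult d w)
qed

lemma of_int_b_el: "of_int \<lfloor>b_rat l1 l2 i x y\<rfloor> = b_rat l1 l2 i x y"
  using b_rat_int by (simp add: of_int_floor_cancel)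

end

theory Submission
  imports Defs
begin

text \<open>
  Words of weight \<open>\<lambda>\<close> are subsets of size \<open>\<lambda>\<^sub>2\<close>, and an element of \<open>S(\<lambda>)\<close> is a matrix whose entry
  at \<open>(x, y)\<close> depends only on the size \<open>s\<close> of the intersection; the entry of \<open>b(i)\<close> is
  \<open>binom(s, \<lambda>\<^sub>2 - i)\<close>.  Over the integers
  \<open>b(i) b(j) = \<Sum>k. binom(k, i) binom(k, j) binom(m + i + j, i + j - k) b(k)\<close>, by induction from \<open>i = 1\<close>.
  Modulo two, Lucas' theorem turns this into \<open>b(2\<^sup>u) b(t) = b(2\<^sup>u + t)\<close> for \<open>t < 2\<^sup>u\<close> and
  \<open>a\<^sub>u\<^sup>2 = a\<^sub>u p\<^sub>u\<close> for \<open>a\<^sub>u = b(2\<^sup>u)\<close>, where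
  \<open>p\<^sub>0 = m\<^sub>0\<close> and \<open>p\<^sub>u\<^sub>+\<^sub>1 = m\<^sub>u\<^sub>+\<^sub>1 + m\<^sub>u + (m\<^sub>u + a\<^sub>u) p\<^sub>u\<close> with the binary digits \<open>m\<^sub>u\<close> of \<open>m\<close>.

  Let \<open>E\<close> be the product of the factors of \<open>e\<^sub>m\<^sub>,\<^sub>g\<close> of index below \<open>u\<close>.  The carries in the
  addition of \<open>m\<close> and \<open>g\<close> follow the recursion for \<open>p\<^sub>u\<close>: \<open>E p\<^sub>u\<close> is \<open>E\<close> if exactly one of \<open>g\<close> and
  \<open>m + g\<close> has the digit \<open>u\<close>, and \<open>0\<close> if neither does.  In the first case \<open>E\<close> splits into the orthogonal
  idempotents \<open>E a\<^sub>u\<close> and \<open>E (1 - a\<^sub>u)\<close>, in the second \<open>E a\<^sub>u\<^sup>2 = 0\<close>.  Consequently \<open>E x\<^sup>2\<close> is a scalar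
  multiple of the final \<open>E\<close> for every \<open>x\<close>, which makes it primitive.  It is nonzero because its
  expansion in the \<open>b(k)\<close> begins with \<open>b(g)\<close>.
\<close>

section \<open>Binomial coefficients modulo two\<close>

text \<open>This is (1 + X)^(2n) = (1 + X^2)^n modulo two. Pascal's rule applied twice gives C(2n+2,
  j+2) = C(2n, j+2) + 2 C(2n, j+1) + C(2n, j), so even and odd lower indices do not mix.\<close>

lemma odd_choose_double:
  "odd ((2 * n) choose (2 * k)) = odd (n choose k) \<and> even ((2 * n) choose Suc (2 * k))"
proof (induction n arbitrary: k)
  case 0
  then show ?case by (cases k) auto
next
  case (Suc n)
  have 2: "2 * Suc n = Suc (Suc (2 * n))" by simp
  show ?case
  proof (cases k)
    case 0
    then show ?thesis using Suc.IH[of 0] by (simp add: 2 del: mult_Suc_right)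
  next
    case (Suc j)
    have "2 * Suc j = Suc (Suc (2 * j))" by simp
    then show ?thesis using Suc.IH[of j] Suc.IH[of "Suc j"] unfolding Suc 2
      by (simp del: mult_Suc_right)
  qed
qed

lemma all_nat_Suc: "(\<forall>u. P u) \<longleftrightarrow> P 0 \<and> (\<forall>u. P (Suc u))"
  by (metis not0_implies_Suc)

text \<open>Lucas' theorem at the prime two; each induction step removes the lowest binary digit of
  \<open>n\<close> and \<open>k\<close>.\<close>

lemma odd_choose_iff_bits: "odd (n choose k) \<longleftrightarrow> (\<forall>u. bit k u \<longrightarrow> bit n u)"
proof (induction k arbitrary: n rule: less_induct)
  case (less k)
  show ?case
  proof (cases "k = 0")
    case True
    then show ?thesis by simp
  next
    case False
    define x y where "x = n div 2" and "y = k div 2"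
    have IH: "odd (x choose y) \<longleftrightarrow> (\<forall>u. bit y u \<longrightarrow> bit x u)"
      using less False by (simp add: y_def)
    have bits: "(\<forall>u. bit k u \<longrightarrow> bit n u) \<longleftrightarrow>
        (odd k \<longrightarrow> odd n) \<and> (\<forall>u. bit y u \<longrightarrow> bit x u)"
      unfolding x_def y_def all_nat_Suc[of "\<lambda>u. bit k u \<longrightarrow> bit n u"]
      by (simp add: bit_0 bit_Suc)
    have half: "z = 2 * (z div 2) \<or> z = Suc (2 * (z div 2))" for z :: nat
      by presburger
    have n: "n = 2 * x \<or> n = Suc (2 * x)" unfolding x_def by (rule half)
    have k: "k = 2 * y \<or> k = Suc (2 * y)" unfolding y_def by (rule half)
    have "odd (n choose k) \<longleftrightarrow> (odd k \<longrightarrow> odd n) \<and> odd (x choose y)"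
    proof (cases y)
      case 0
      then show ?thesis using n k False by auto
    next
      case (Suc z)
      have "2 * y = Suc (Suc (2 * z))" using Suc by simp
      then show ?thesis
        using n k odd_choose_double[of x y] odd_choose_double[of x z] by auto
    qed
    then show ?thesis using IH bits by simp
  qed
qed

section \<open>Binary digits of sums\<close>

lemma bit_add_mult_power: "bit (x + 2 ^ u * y :: nat) u \<longleftrightarrow> bit x u \<noteq> odd y"
  by (auto simp: bit_iff_odd)

lemma bit_add_mult_power_less:
  assumes "v < u" shows "bit (x + 2 ^ u * y :: nat) v \<longleftrightarrow> bit x v"
proof -
  obtain w where "u = v + Suc w" using assms less_iff_Suc_add by auto
  then have "x + 2 ^ u * y = x + 2 ^ v * (2 * (2 ^ w * y))" by (simp add: power_add algebra_simps)
  then show ?thesis by (metis bit_add_mult_power dvd_triv_left)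
qed

lemma bit_add_disjoint:
  fixes x y :: nat
  assumes "\<forall>u. \<not> (bit x u \<and> bit y u)" shows "bit (x + y) u \<longleftrightarrow> bit x u \<or> bit y u"
  using assms by (subst disjunctive_add_eq_or) (auto simp: bit_eq_iff bit_simps)

lemma bit_less_power: "bit (t::nat) v \<Longrightarrow> t < 2 ^ u \<Longrightarrow> v < u"
proof (rule ccontr)
  assume *: "bit t v" "t < 2 ^ u" "\<not> v < u"
  then have "t < 2 ^ v"
    using power_increasing[of u v "2::nat"] by linarith
  then show False using *(1) by (simp add: bit_iff_odd)
qed

lemma bit_power_add:
  assumes "t < 2 ^ u" shows "bit (2 ^ u + t :: nat) v \<longleftrightarrow> v = u \<or> bit t v"
proof -
  have "\<not> (bit (2 ^ u :: nat) v \<and> bit t v)" for v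
    using bit_less_power[OF _ assms, of v] by (auto simp: bit_exp_iff)
  then show ?thesis by (subst bit_add_disjoint) (auto simp: bit_exp_iff)
qed

lemma odd_choose_power_right: "odd (k choose 2 ^ u) \<longleftrightarrow> bit k u"
  by (auto simp: odd_choose_iff_bits bit_simps)

lemma odd_choose_power_add_right:
  assumes "t < 2 ^ u" shows "odd (n choose (2 ^ u + t)) \<longleftrightarrow> bit n u \<and> odd (n choose t)"
  using assms by (auto simp: odd_choose_iff_bits bit_power_add)

lemma odd_choose_power_add_left:
  assumes "t < 2 ^ u" "j < 2 ^ u" shows "odd ((2 ^ u + t) choose j) \<longleftrightarrow> odd (t choose j)"
  using assms by (auto simp: odd_choose_iff_bits bit_power_add dest: bit_less_power)

text \<open>The digits of \<open>t\<close> lie at positions up to \<open>u\<close>, where adding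
  2^(u+1) changes nothing. The end value t = 2^u is included because it occurs in the square of
  b(2^u).\<close>

lemma odd_choose_add_double_power:
  assumes "t \<le> 2 ^ u" shows "odd ((n + 2 ^ Suc u) choose t) \<longleftrightarrow> odd (n choose t)"
proof -
  have "t < 2 ^ Suc u" using assms by (simp add: le_less_trans)
  then have "bit (n + 2 ^ Suc u) v \<longleftrightarrow> bit n v" if "bit t v" for v
    using bit_add_mult_power_less[of v "Suc u" n 1] bit_less_power[OF that] by simp
  then show ?thesis by (auto simp: odd_choose_iff_bits)
qed

text \<open>Kummer's criterion for addition without carries. Induction on the position: disjoint
  digits below \<open>u\<close> send no carry into \<open>u\<close>, so if both digits at
  \<open>u\<close> were one, the sum would have digit zero where \<open>x\<close> has digit one,
  against Lucas.\<close>

lemma odd_choose_add_iff_disjoint: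
  "odd ((x + y) choose x) \<longleftrightarrow> (\<forall>u. \<not> (bit x u \<and> bit y u))"
proof
  assume *: "odd ((x + y) choose x)"
  have "\<not> (bit x u \<and> bit y u)" for u
  proof (induction u rule: less_induct)
    case (less u)
    have xy: "x = x mod 2 ^ u + 2 ^ u * (x div 2 ^ u)" "y = y mod 2 ^ u + 2 ^ u * (y div 2 ^ u)"
      by simp_all
    have "\<not> (bit (x mod 2 ^ u) v \<and> bit (y mod 2 ^ u) v)" for v
      using less by (simp add: bit_take_bit_iff flip: take_bit_eq_mod)
    then have "\<not> bit (x mod 2 ^ u + y mod 2 ^ u) u"
      by (subst bit_add_disjoint) (auto simp: bit_take_bit_iff simp flip: take_bit_eq_mod)
    moreover have "x + y = (x mod 2 ^ u + y mod 2 ^ u) + 2 ^ u * (x div 2 ^ u + y div 2 ^ u)"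
      using xy by (simp add: algebra_simps)
    ultimately have "bit (x + y) u \<longleftrightarrow> odd (x div 2 ^ u + y div 2 ^ u)"
      by (metis bit_add_mult_power)
    then show ?case using * by (auto simp: odd_choose_iff_bits bit_iff_odd)
  qed
  then show "\<forall>u. \<not> (bit x u \<and> bit y u)" by blast
next
  assume "\<forall>u. \<not> (bit x u \<and> bit y u)"
  from bit_add_disjoint[OF this] show "odd ((x + y) choose x)"
    by (simp add: odd_choose_iff_bits)
qed

text \<open>The digits u+1 of g and m + g differ exactly when m_(u+1) plus the carry out of position
  \<open>u\<close> is odd. That carry is m_u, 1 and 0 in the three cases; disjointness excludes the
  fourth, where both digits are one.\<close>

lemma bit_add_Suc_cases:
  fixes m g :: nat
  shows "\<not> bit g u \<Longrightarrow> \<not> bit (m + g) u \<Longrightarrow>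
      (bit g (Suc u) \<noteq> bit (m + g) (Suc u)) = (bit m (Suc u) \<noteq> bit m u)"
    and "bit g u \<Longrightarrow> \<not> bit (m + g) u \<Longrightarrow>
      (bit g (Suc u) \<noteq> bit (m + g) (Suc u)) = (\<not> bit m (Suc u))"
    and "\<not> bit g u \<Longrightarrow> bit (m + g) u \<Longrightarrow>
      (bit g (Suc u) \<noteq> bit (m + g) (Suc u)) = bit m (Suc u)"
proof -
  define A B C where "A = m div 2 ^ u" and "B = g div 2 ^ u" and "C = (m + g) div 2 ^ u"
  define c where "c = (m mod 2 ^ u + g mod 2 ^ u) div 2 ^ u"
  have "m mod 2 ^ u + g mod 2 ^ u < 2 ^ u * 2" by (simp add: add_strict_mono mult_2_right)
  then have "c < 2" unfolding c_def by (simp add: less_mult_imp_div_less mult.commute)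
  then have c: "c = 0 \<or> c = 1" by auto
  have C: "C = A + B + c" unfolding A_def B_def C_def c_def by (rule div_add1_eq)
  have bits: "bit m u = odd A" "bit m (Suc u) = odd (A div 2)"
    "bit g u = odd B" "bit g (Suc u) = odd (B div 2)"
    "bit (m + g) u = odd C" "bit (m + g) (Suc u) = odd (C div 2)"
    unfolding A_def B_def C_def by (simp_all only: bit_iff_odd div_mult2_eq power_Suc2)
  define x y where "x = A div 2" and "y = B div 2"
  have AB: "A = 2 * x \<or> A = Suc (2 * x)" "B = 2 * y \<or> B = Suc (2 * y)"
    unfolding x_def y_def by (simp_all add: mult_2, presburger+)
  show "\<not> bit g u \<Longrightarrow> \<not> bit (m + g) u \<Longrightarrow>
      (bit g (Suc u) \<noteq> bit (m + g) (Suc u)) = (bit m (Suc u) \<noteq> bit m u)"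
    unfolding bits using AB c unfolding C by (elim disjE; simp; blast?)+
  show "bit g u \<Longrightarrow> \<not> bit (m + g) u \<Longrightarrow>
      (bit g (Suc u) \<noteq> bit (m + g) (Suc u)) = (\<not> bit m (Suc u))"
    unfolding bits using AB c unfolding C by (elim disjE; simp; blast?)+
  show "\<not> bit g u \<Longrightarrow> bit (m + g) u \<Longrightarrow>
      (bit g (Suc u) \<noteq> bit (m + g) (Suc u)) = bit m (Suc u)"
    unfolding bits using AB c unfolding C by (elim disjE; simp; blast?)+
qed

section \<open>Orthogonal idempotents from a tower of quadratic relations\<close>

text \<open>With \<open>a\<^sub>u = b(2\<^sup>u)\<close> this is the element \<open>\<Sum>t<2\<^sup>u. binom(m, 2\<^sup>u - t) b(t)\<close>; the recursion shows that it
  is idempotent as soon as each \<open>a\<^sub>v\<^sup>2\<close> is \<open>a\<^sub>v\<close> times the \<open>v\<close>-th such element.\<close>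

primrec tower_coeff :: "('a, 'b) ring_scheme \<Rightarrow> nat \<Rightarrow> (nat \<Rightarrow> 'a) \<Rightarrow> nat \<Rightarrow> 'a" where
  "tower_coeff R m a 0 = (if bit m 0 then \<one>\<^bsub>R\<^esub> else \<zero>\<^bsub>R\<^esub>)"
| "tower_coeff R m a (Suc u) =
     (if bit m (Suc u) = bit m u then \<zero>\<^bsub>R\<^esub> else \<one>\<^bsub>R\<^esub>) \<oplus>\<^bsub>R\<^esub>
     ((if bit m u then \<one>\<^bsub>R\<^esub> else \<zero>\<^bsub>R\<^esub>) \<oplus>\<^bsub>R\<^esub> a u) \<otimes>\<^bsub>R\<^esub> tower_coeff R m a u"

text \<open>As m + 2g = g + (m + g), this holds for every \<open>u\<close> exactly when C(m + 2g, g)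
  is odd. The truncation at \<open>u\<close> is what an induction over the factors needs.\<close>

definition bits_disjoint :: "nat \<Rightarrow> nat \<Rightarrow> nat \<Rightarrow> bool" where
  "bits_disjoint m u g \<longleftrightarrow> (\<forall>v<u. \<not> (bit g v \<and> bit (m + g) v))"

lemma bits_disjoint_0 [simp]: "bits_disjoint m 0 g"
  by (simp add: bits_disjoint_def)

lemma bits_disjoint_Suc:
  "bits_disjoint m (Suc u) g \<longleftrightarrow> bits_disjoint m u g \<and> \<not> (bit g u \<and> bit (m + g) u)"
  by (auto simp: bits_disjoint_def less_Suc_eq)

text \<open>Collects what follows formally from a_u^2 = a_u p_u in a commutative ring with 1 + 1 =
  0: idempotency, orthogonality and the sum. Non-vanishing and primitivity use the b(k) and come
  later.\<close>

locale char2_tower = cring R for R (structure) +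
  fixes a :: "nat \<Rightarrow> 'a" and m :: nat
  assumes char2: "\<one> \<oplus> \<one> = \<zero>"
    and a_closed [simp]: "a u \<in> carrier R"
    and a_square: "a u \<otimes> a u = a u \<otimes> tower_coeff R m a u"
begin

abbreviation p where "p \<equiv> tower_coeff R m a"

text \<open>When g and m + g have disjoint digits, m + 2g has the digits of both, so the tests on
  \<open>g\<close> and \<open>m + g\<close> describe J_(m,g) and I_(m,g).\<close>

definition factor :: "nat \<Rightarrow> nat \<Rightarrow> 'a" where
  "factor g u = (if bit g u then a u else if bit (m + g) u then \<one> \<ominus> a u else \<one>)"

primrec idem :: "nat \<Rightarrow> nat \<Rightarrow> 'a" where
  "idem g 0 = \<one>"
| "idem g (Suc u) = idem g u \<otimes> factor g u"

lemma add_self [simp]: "x \<in> carrier R \<Longrightarrow> x \<oplus> x = \<zero>"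
  using l_distr[of \<one> \<one> x] char2 by simp

lemma add_self_left [simp]:
  "x \<in> carrier R \<Longrightarrow> y \<in> carrier R \<Longrightarrow> x \<oplus> (x \<oplus> y) = y"
  by (simp flip: a_assoc)

lemma minus_eq_add: "x \<in> carrier R \<Longrightarrow> y \<in> carrier R \<Longrightarrow> x \<ominus> y = x \<oplus> y"
  using minus_equality[of y y] by (simp add: a_minus_def)

lemma p_closed [simp]: "p u \<in> carrier R"
  by (induction u) auto

lemma factor_closed [simp]: "factor g u \<in> carrier R"
  by (simp add: factor_def)

lemma idem_closed [simp]: "idem g u \<in> carrier R"
  by (induction u) auto

lemma idem_p_Suc:
  assumes e: "e \<in> carrier R" and ep: "e \<otimes> p u = (if d then e else \<zero>)"
  shows "e \<otimes> p (Suc u) =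
    (if bit m (Suc u) = bit m u then \<zero> else e) \<oplus>
    (if d then (if bit m u then e else \<zero>) \<oplus> e \<otimes> a u else \<zero>)"
proof -
  have "e \<otimes> (a u \<otimes> p u) = a u \<otimes> (e \<otimes> p u)"
    using e by (simp add: m_lcomm)
  then show ?thesis using e ep by (simp add: r_distr l_distr m_comm)
qed

text \<open>The claims need a joint induction: the second one at \<open>u\<close> determines E
  a_u^2, hence idempotency at u+1, and the recursion for \<open>p\<close> reproduces the carry rule
  of \<open>bit_add_Suc_cases\<close>.\<close>

lemma idem_step:
  assumes "bits_disjoint m u g"
  shows "idem g u \<otimes> idem g u = idem g u"
    and "idem g u \<otimes> p u = (if bit g u = bit (m + g) u then \<zero> else idem g u)"
proof -
  have "idem g u \<otimes> idem g u = idem g u \<and>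
      idem g u \<otimes> p u = (if bit g u \<noteq> bit (m + g) u then idem g u else \<zero>)"
    using assms
  proof (induction u)
    case 0
    then show ?case by (simp add: bit_0)
  next
    case (Suc u)
    define e d where "e = idem g u" and "d = (bit g u \<noteq> bit (m + g) u)"
    have e [simp]: "e \<in> carrier R" by (simp add: e_def)
    have ee: "e \<otimes> e = e" and ep: "e \<otimes> p u = (if d then e else \<zero>)"
      using Suc by (simp_all add: bits_disjoint_Suc e_def d_def)
    have eex: "e \<otimes> (e \<otimes> x) = e \<otimes> x" if "x \<in> carrier R" for x
      using that ee by (simp flip: m_assoc)
    have eaa: "e \<otimes> (a u \<otimes> a u) = (if d then e \<otimes> a u else \<zero>)"
      using ep by (simp add: a_square m_lcomm[of e] m_comm[of e "a u"])
    have eP: "e \<otimes> p (Suc u) =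
      (if bit m (Suc u) = bit m u then \<zero> else e) \<oplus>
      (if d then (if bit m u then e else \<zero>) \<oplus> e \<otimes> a u else \<zero>)"
      by (rule idem_p_Suc[OF e ep])
    have nb: "\<not> (bit g u \<and> bit (m + g) u)" using Suc.prems by (simp add: bits_disjoint_Suc)
    consider "\<not> bit g u" "\<not> bit (m + g) u" | "bit g u" "\<not> bit (m + g) u" | "\<not> bit g u" "bit (m + g) u"
      using nb by blast
    then show ?case
    proof cases
      case 1
      then have s: "idem g (Suc u) = e" and d: "\<not> d"
        by (simp_all add: factor_def e_def d_def)
      show ?thesis unfolding s using eP ee d bit_add_Suc_cases(1)[OF 1]
        by (simp del: tower_coeff.simps)
    next
      case 2
      then have s: "idem g (Suc u) = e \<otimes> a u" and d: d
        by (simp_all add: factor_def e_def d_def)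
      have aa: "e \<otimes> (a u \<otimes> a u) = e \<otimes> a u" using eaa d by simp
      have "(e \<otimes> a u) \<otimes> (e \<otimes> a u) = e \<otimes> a u"
        using aa by (simp add: m_assoc m_lcomm[of "a u" e] eex)
      moreover have "(e \<otimes> a u) \<otimes> p (Suc u) = a u \<otimes> (e \<otimes> p (Suc u))"
        by (simp add: m_ac del: tower_coeff.simps)
      \<comment> \<open>As e a_u^2 = e a_u, the coefficient of e a_u is (m_(u+1) + m_u) + m_u + 1 =
        m_(u+1) + 1 modulo two.\<close>
      moreover have "a u \<otimes> (e \<otimes> p (Suc u)) = (if bit m (Suc u) then \<zero> else e \<otimes> a u)"
        unfolding eP using d aa by (auto simp: r_distr m_lcomm[of "a u" e] m_comm[of "a u" e] a_ac)
      ultimately show ?thesis unfolding s using bit_add_Suc_cases(2)[OF 2]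
        by (simp del: tower_coeff.simps)
    next
      case 3
      then have s: "idem g (Suc u) = e \<oplus> e \<otimes> a u" and d: d
        by (simp_all add: factor_def e_def d_def minus_eq_add r_distr)
      have aa: "e \<otimes> (a u \<otimes> a u) = e \<otimes> a u" using eaa d by simp
      have "(e \<oplus> e \<otimes> a u) \<otimes> (e \<oplus> e \<otimes> a u) = e \<oplus> e \<otimes> a u"
        using aa by (simp add: r_distr l_distr m_assoc m_lcomm[of "a u" e] m_comm[of "a u" e] ee eex a_ac)
      moreover have "(e \<oplus> e \<otimes> a u) \<otimes> p (Suc u) = e \<otimes> p (Suc u) \<oplus> a u \<otimes> (e \<otimes> p (Suc u))"
        by (simp add: l_distr m_assoc m_lcomm[of "a u" e] del: tower_coeff.simps)
      \<comment> \<open>The coefficient of \<open>e\<close> is (m_(u+1) + m_u) + m_u = m_(u+1). That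
        of e a_u is 1 + (m_(u+1) + 1), where the second part comes from the product with
        \<open>a u\<close>.\<close>
      moreover have "e \<otimes> p (Suc u) \<oplus> a u \<otimes> (e \<otimes> p (Suc u)) =
          (if bit m (Suc u) then e \<oplus> e \<otimes> a u else \<zero>)"
        unfolding eP using d aa by (auto simp: r_distr m_lcomm[of "a u" e] m_comm[of "a u" e] a_ac)
      ultimately show ?thesis unfolding s using bit_add_Suc_cases(3)[OF 3]
        by (simp del: tower_coeff.simps)
    qed
  qed
  then show "idem g u \<otimes> idem g u = idem g u"
    and "idem g u \<otimes> p u = (if bit g u = bit (m + g) u then \<zero> else idem g u)"
    by auto
qed

lemma idem_a_square:
  assumes "bits_disjoint m u g"
  shows "idem g u \<otimes> (a u \<otimes> a u) =
    (if bit g u = bit (m + g) u then \<zero> else idem g u \<otimes> a u)"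
proof -
  have "idem g u \<otimes> (a u \<otimes> a u) = a u \<otimes> (idem g u \<otimes> p u)"
    by (simp add: a_square m_lcomm)
  then show ?thesis using idem_step(2)[OF assms] by (simp add: m_comm)
qed

text \<open>The factor at position \<open>u\<close> decides. With e the product before it: for a_u
  one has e a_u^2 = e a_u, so the product is absorbed; for 1 - a_u it becomes e a_u (1 - a_u) = 0;
  for 1 already e a_u^2 = 0. Later factors just multiply the outcome.\<close>

lemma idem_mult_a_square:
  assumes "bits_disjoint m U g" "u < U"
  shows "idem g U \<otimes> (a u \<otimes> a u) \<in> {\<zero>, idem g U}"
  using assms
proof (induction U)
  case (Suc U)
  show ?case
  proof (cases "u = U")
    case False
    have "idem g (Suc U) \<otimes> (a u \<otimes> a u) = (idem g U \<otimes> (a u \<otimes> a u)) \<otimes> factor g U"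
      by (simp add: m_ac)
    then show ?thesis using Suc False by (auto simp: bits_disjoint_Suc)
  next
    case True
    define e where "e = idem g U"
    have e [simp]: "e \<in> carrier R" by (simp add: e_def)
    have disj: "bits_disjoint m U g" and nb: "\<not> (bit g U \<and> bit (m + g) U)"
      using Suc.prems by (simp_all add: bits_disjoint_Suc)
    have *: "idem g (Suc U) \<otimes> (a u \<otimes> a u) = (e \<otimes> (a U \<otimes> a U)) \<otimes> factor g U"
      by (simp add: m_ac True e_def)
    have eaa: "e \<otimes> (a U \<otimes> a U) = (if bit g U = bit (m + g) U then \<zero> else e \<otimes> a U)"
      unfolding e_def by (rule idem_a_square[OF disj])
    show ?thesis unfolding * using nb eaa
      by (auto simp: factor_def e_def[symmetric] minus_eq_add r_distr m_assoc)
  qed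
qed simp

text \<open>Adding a multiple of 2^u to \<open>g\<close> leaves all digits of g and m + g below
  \<open>u\<close> alone and flips the two digits at \<open>u\<close> together or not at
  all.\<close>

lemma idem_cong_mod:
  assumes "g mod 2 ^ u = h mod 2 ^ u"
  shows "idem g u = idem h u" and "bits_disjoint m u g = bits_disjoint m u h"
    and "(bit g u = bit (m + g) u) = (bit h u = bit (m + h) u)"
proof -
  define r where "r = g mod 2 ^ u"
  have g: "g = r + 2 ^ u * (g div 2 ^ u)" "m + g = (m + r) + 2 ^ u * (g div 2 ^ u)"
    by (simp_all add: r_def)
  have h: "h = r + 2 ^ u * (h div 2 ^ u)" "m + h = (m + r) + 2 ^ u * (h div 2 ^ u)"
    unfolding r_def assms by simp_all
  have bits: "bit g v = bit h v" "bit (m + g) v = bit (m + h) v" if "v < u" for v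
    using bit_add_mult_power_less[OF that] g h by metis+
  then show "bits_disjoint m u g = bits_disjoint m u h" by (auto simp: bits_disjoint_def)
  have "w \<le> u \<Longrightarrow> idem g w = idem h w" for w
    by (induction w) (auto simp: factor_def bits)
  then show "idem g u = idem h u" by blast
  show "(bit g u = bit (m + g) u) = (bit h u = bit (m + h) u)"
    using bit_add_mult_power[of _ u] g h by metis
qed

lemma idem_orthogonal:
  assumes "bits_disjoint m u g" "bits_disjoint m u h" "g mod 2 ^ u \<noteq> h mod 2 ^ u"
  shows "idem g u \<otimes> idem h u = \<zero>"
  using assms
proof (induction u)
  case (Suc u)
  note disj = Suc.prems(1,2)[unfolded bits_disjoint_Suc]
  show ?case
  proof (cases "g mod 2 ^ u = h mod 2 ^ u")
    case False
    have "idem g (Suc u) \<otimes> idem h (Suc u) = (idem g u \<otimes> idem h u) \<otimes> (factor g u \<otimes> factor h u)"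
      by (simp add: m_ac)
    then show ?thesis using Suc.IH disj False by simp
  next
    case True
    have split: "x mod 2 ^ Suc u = x mod 2 ^ u + 2 ^ u * of_bool (bit x u)" for x :: nat
      by (simp add: mod_mult2_eq bit_iff_odd mod_2_eq_odd power_Suc2 del: power_Suc)
    have "bit g u \<noteq> bit h u"
      using Suc.prems(3) True unfolding split by auto
    define e where "e = idem g u"
    have e [simp]: "e \<in> carrier R" by (simp add: e_def)
    have eh: "idem h u = e" using idem_cong_mod(1)[OF True] by (simp add: e_def)
    \<comment> \<open>Whichever index has digit \<open>u\<close>, disjointness keeps that digit out
      of its sum with \<open>m\<close>; congruence carries the inequality over to the other index.
      Hence the two factors at \<open>u\<close> are \<open>a u\<close> and
      \<open>\<one> \<ominus> a u\<close>.\<close>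
    have xor: "bit g u \<noteq> bit (m + g) u" "bit h u \<noteq> bit (m + h) u"
      using idem_cong_mod(3)[OF True] \<open>bit g u \<noteq> bit h u\<close> disj by auto
    have aa: "e \<otimes> (a u \<otimes> a u) = e \<otimes> a u"
      using idem_a_square[of u g] disj xor by (simp add: e_def)
    have "idem g (Suc u) \<otimes> idem h (Suc u) = (e \<otimes> e) \<otimes> (a u \<otimes> (\<one> \<oplus> a u))"
      using xor \<open>bit g u \<noteq> bit h u\<close>
      by (auto simp: factor_def eh e_def[symmetric] minus_eq_add m_ac)
    also have "e \<otimes> e = e" using idem_step(1)[of u g] disj by (simp add: e_def)
    finally show ?thesis using aa by (simp add: r_distr)
  qed
qed simp

text \<open>Passing from u to u+1 preserves the sum: an index g for which m + g has digit u splits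
  into g and 2^u + g, with idempotents E (1 - a_u) and E a_u, and every other E stays.\<close>

lemma idem_sum: "(\<Oplus>g\<in>{g. g < 2 ^ u \<and> bits_disjoint m u g}. idem g u) = \<one>"
proof (induction u)
  case 0
  have "{g. g < 2 ^ 0 \<and> bits_disjoint m 0 g} = {0}" by auto
  then show ?case by simp
next
  case (Suc u)
  let ?G = "\<lambda>u. {g. g < 2 ^ u \<and> bits_disjoint m u g}"
  let ?B = "{g \<in> ?G u. bit (m + g) u}"
  have less: "\<not> bit g u" if "g < 2 ^ u" for g :: nat
    using that bit_less_power by blast
  have up: "idem (2 ^ u + g) u = idem g u" "bits_disjoint m u (2 ^ u + g) = bits_disjoint m u g"
    for g using idem_cong_mod(1,2)[of "2 ^ u + g" u g] by simp_all
  have top: "bit (2 ^ u + g) u" "bit (m + (2 ^ u + g)) u \<longleftrightarrow> \<not> bit (m + g) u" if "g < 2 ^ u" for g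
    using that less[OF that] bit_add_mult_power[of g u 1] bit_add_mult_power[of "m + g" u 1]
    by (simp_all add: ac_simps)
  \<comment> \<open>Adding 2^u to \<open>g\<close> clears digit \<open>u\<close> of m + g if it was
    set and sets it otherwise; only the former keeps the digits disjoint.\<close>
  have split: "?G (Suc u) = ?G u \<union> (+) (2 ^ u) ` ?B"
  proof (intro equalityI subsetI)
    fix g assume g: "g \<in> ?G (Suc u)"
    show "g \<in> ?G u \<union> (+) (2 ^ u) ` ?B"
    proof (cases "g < 2 ^ u")
      case False
      define h where "h = g - 2 ^ u"
      have "g = 2 ^ u + h" "h < 2 ^ u" using g False by (auto simp: h_def)
      then show ?thesis using g up top by (auto simp: bits_disjoint_Suc)
    qed (use g in \<open>simp add: bits_disjoint_Suc\<close>)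
  next
    fix g assume "g \<in> ?G u \<union> (+) (2 ^ u) ` ?B"
    then show "g \<in> ?G (Suc u)"
      using up top less by (auto simp: bits_disjoint_Suc)
  qed
  have inj: "inj_on ((+) (2 ^ u)) ?B" by simp
  have "(\<Oplus>g\<in>?G (Suc u). idem g (Suc u)) =
      (\<Oplus>g\<in>?G u. idem g (Suc u)) \<oplus> (\<Oplus>g\<in>(+) (2 ^ u) ` ?B. idem g (Suc u))"
    unfolding split by (rule add.finprod_Un_disjoint) (auto simp del: idem.simps)
  also have "(\<Oplus>g\<in>(+) (2 ^ u) ` ?B. idem g (Suc u)) = (\<Oplus>g\<in>?B. idem (2 ^ u + g) (Suc u))"
    by (rule finsum_reindex[OF _ inj]) (auto simp del: idem.simps)
  also have "\<dots> = (\<Oplus>g\<in>?B. idem g u \<otimes> a u)"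
    by (rule finsum_cong') (auto simp: up factor_def top)
  also have "\<dots> = (\<Oplus>g\<in>?G u. if bit (m + g) u then idem g u \<otimes> a u else \<zero>)"
    by (rule add.finprod_mono_neutral_cong) auto
  also have "(\<Oplus>g\<in>?G u. idem g (Suc u)) \<oplus> \<dots> =
      (\<Oplus>g\<in>?G u. idem g (Suc u) \<oplus> (if bit (m + g) u then idem g u \<otimes> a u else \<zero>))"
    by (rule finsum_addf[symmetric]) (auto simp del: idem.simps)
  also have "\<dots> = (\<Oplus>g\<in>?G u. idem g u)"
    by (rule finsum_cong') (auto simp: factor_def less minus_eq_add r_distr a_assoc)
  finally show ?case using Suc.IH by simp
qed

end

section \<open>The weight algebra as an orbit algebra\<close>

definition twos :: "nat \<Rightarrow> nat list \<Rightarrow> nat set" where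
  "twos n x = {k. k < n \<and> x ! k = 2}"

definition weight_words :: "nat \<Rightarrow> nat \<Rightarrow> nat list set" where
  "weight_words l1 l2 = {x \<in> tensor_words (l1 + l2). card (twos (l1 + l2) x) = l2}"

text \<open>Orbits of place permutations on pairs of words of weight \<lambda> are given by the
  intersection size, so these matrices form the Bose-Mesner algebra of a Johnson scheme.\<close>

definition orbit_endo :: "nat \<Rightarrow> nat \<Rightarrow> (nat \<Rightarrow> 'k) \<Rightarrow> 'k::comm_ring_1 endo" where
  "orbit_endo l1 l2 \<phi> = (\<lambda>x y. if x \<in> weight_words l1 l2 \<and> y \<in> weight_words l1 l2
     then \<phi> (card (twos (l1 + l2) x \<inter> twos (l1 + l2) y)) else 0)"

lemma twos_subset: "twos n x \<subseteq> {..<n}"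
  by (auto simp: twos_def)

lemma finite_twos [simp]: "finite (twos n x)"
  using finite_subset[OF twos_subset] by blast

lemma tensor_words_nth: "x \<in> tensor_words n \<Longrightarrow> k < n \<Longrightarrow> x ! k = 1 \<or> x ! k = 2"
  by (auto simp: tensor_words_def dest: nth_mem)

lemma twos_eq_iff:
  assumes "x \<in> tensor_words n" "y \<in> tensor_words n"
  shows "twos n x = twos n y \<longleftrightarrow> x = y"
proof
  assume *: "twos n x = twos n y"
  show "x = y"
  proof (rule nth_equalityI)
    fix k assume "k < length x"
    then have k: "k < n" using assms by (simp add: tensor_words_def)
    then have "x ! k = 2 \<longleftrightarrow> y ! k = 2" using * by (auto simp: twos_def)
    then show "x ! k = y ! k" using tensor_words_nth[OF _ k] assms by metis
  qed (use assms in \<open>simp add: tensor_words_def\<close>)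
qed simp

lemma bij_betw_twos: "bij_betw (twos n) (tensor_words n) (Pow {..<n})"
proof (rule bij_betw_imageI)
  show "inj_on (twos n) (tensor_words n)" by (auto simp: inj_on_def twos_eq_iff)
  show "twos n ` tensor_words n = Pow {..<n}"
  proof (intro equalityI subsetI)
    fix A assume A: "A \<in> Pow {..<n}"
    let ?x = "map (\<lambda>k. if k \<in> A then 2 else 1 :: nat) [0..<n]"
    have "?x \<in> tensor_words n" by (auto simp: tensor_words_def)
    moreover have "twos n ?x = A" using A by (auto simp: twos_def split: if_splits)
    ultimately show "A \<in> twos n ` tensor_words n" by blast
  qed (use twos_subset in auto)
qed

lemma bij_betw_twos_weight:
  "bij_betw (twos (l1 + l2)) (weight_words l1 l2) {Z. Z \<subseteq> {..<l1 + l2} \<and> card Z = l2}"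
proof -
  have "bij_betw (twos (l1 + l2)) (weight_words l1 l2) (twos (l1 + l2) ` weight_words l1 l2)"
    by (rule bij_betw_subset[OF bij_betw_twos]) (auto simp: weight_words_def)
  moreover have "twos (l1 + l2) ` weight_words l1 l2 = {Z \<in> twos (l1 + l2) ` tensor_words (l1 + l2). card Z = l2}"
    by (auto simp: weight_words_def)
  ultimately show ?thesis
    unfolding bij_betw_imp_surj_on[OF bij_betw_twos] by (simp add: Pow_def)
qed

lemma weight_words_subset: "weight_words l1 l2 \<subseteq> tensor_words (l1 + l2)"
  by (auto simp: weight_words_def)

lemma finite_weight_words [simp]: "finite (weight_words l1 l2)"
  using finite_subset[OF weight_words_subset finite_tensor_words] .

lemma card_twos: "x \<in> tensor_words n \<Longrightarrow> card (twos n x) = count_list x 2"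
  by (auto simp: twos_def tensor_words_def count_list_eq_length_filter length_filter_conv_card eq_commute)

lemma weight_idem_eq:
  "weight_idem l1 l2 = (\<lambda>x y. if x \<in> weight_words l1 l2 \<and> x = y then 1 else (0::'k::comm_ring_1))"
proof -
  have "count_list x 1 + count_list x 2 = l1 + l2" if "x \<in> tensor_words (l1 + l2)" for x
  proof -
    have "filter (\<lambda>y. \<not> 1 = y) x = filter ((=) 2) x"
      using that by (intro filter_cong) (auto simp: tensor_words_def)
    then show ?thesis using sum_length_filter_compl[of "(=) 1" x] that
      by (simp add: count_list_eq_length_filter tensor_words_def)
  qed
  then show ?thesis
    by (intro ext) (force simp: weight_idem_def weight_words_def card_twos)
qed

section \<open>Matrix formulas for the operations of S(\<lambda>)\<close>

lemma S_mult: "A \<otimes>\<^bsub>schur_weight_algebra l1 l2\<^esub> B =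
    (\<lambda>x y. \<Sum>z\<in>tensor_words (l1 + l2). A x z * B z y)"
  by (simp add: schur_weight_algebra_def schur_algebra_def tensor_End_def)

lemma S_add: "A \<oplus>\<^bsub>schur_weight_algebra l1 l2\<^esub> B = (\<lambda>x y. A x y + B x y)"
  by (simp add: schur_weight_algebra_def schur_algebra_def tensor_End_def)

lemma S_zero: "\<zero>\<^bsub>schur_weight_algebra l1 l2\<^esub> = (\<lambda>x y. 0)"
  by (simp add: schur_weight_algebra_def schur_algebra_def tensor_End_def)

lemma S_one: "\<one>\<^bsub>schur_weight_algebra l1 l2\<^esub> = weight_idem l1 l2"
  by (simp add: schur_weight_algebra_def)

lemma sum_words_restrict:
  fixes f :: "nat list \<Rightarrow> 'k::comm_ring_1"
  assumes "\<And>z. z \<notin> weight_words l1 l2 \<Longrightarrow> f z = 0"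
  shows "(\<Sum>z\<in>tensor_words (l1 + l2). f z) = (\<Sum>z\<in>weight_words l1 l2. f z)"
  using assms by (intro sum.mono_neutral_right finite_tensor_words weight_words_subset) auto

lemma weight_idem_mult_left:
  "(\<Sum>z\<in>tensor_words (l1 + l2). weight_idem l1 l2 x z * f z) =
     (if x \<in> weight_words l1 l2 then f x else (0::'k::comm_ring_1))"
  by (subst sum_words_restrict) (auto simp: weight_idem_eq if_distrib[of "\<lambda>t. t * _"] cong: if_cong)

lemma weight_idem_mult_right:
  "(\<Sum>z\<in>tensor_words (l1 + l2). f z * weight_idem l1 l2 z y) =
     (if y \<in> weight_words l1 l2 then f y else (0::'k::comm_ring_1))"
  by (subst sum_words_restrict) (auto simp: weight_idem_eq if_distrib[of "\<lambda>t. _ * t"] cong: if_cong)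

lemma weight_idem_sandwich:
  "weight_idem l1 l2 \<otimes>\<^bsub>schur_algebra (l1 + l2)\<^esub> M \<otimes>\<^bsub>schur_algebra (l1 + l2)\<^esub> weight_idem l1 l2 =
    (\<lambda>x y. if x \<in> weight_words l1 l2 \<and> y \<in> weight_words l1 l2 then M x y else (0::'k::comm_ring_1))"
  by (intro ext) (simp add: schur_algebra_def tensor_End_def weight_idem_mult_right weight_idem_mult_left)

subsection \<open>Orbits of place permutations\<close>

lemma bij_betw_permute_list:
  assumes "\<sigma> permutes {..<n}"
  shows "bij_betw (permute_list \<sigma>) (tensor_words n) (tensor_words n)"
proof -
  have into: "permute_list \<sigma> x \<in> tensor_words n" if "x \<in> tensor_words n" "\<sigma> permutes {..<n}" for \<sigma> x
    using that by (simp add: tensor_words_def)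
  have inj: "inj_on (permute_list \<sigma>) (tensor_words n)"
  proof (rule inj_onI)
    fix x y
    assume x: "x \<in> tensor_words n" "y \<in> tensor_words n" "permute_list \<sigma> x = permute_list \<sigma> y"
    have "x ! k = y ! k" if "k < n" for k
    proof -
      have "k \<in> \<sigma> ` {..<n}" using permutes_image[OF assms] that by simp
      then obtain l where l: "k = \<sigma> l" "l < n" by auto
      have "permute_list \<sigma> x ! l = permute_list \<sigma> y ! l" using x by simp
      moreover have "permute_list \<sigma> z ! l = z ! k" if "z \<in> tensor_words n" for z
        using that l assms by (simp add: permute_list_nth tensor_words_def)
      ultimately show ?thesis using x by metis
    qed
    then show "x = y" using x by (intro nth_equalityI) (auto simp: tensor_words_def)
  qed
  have "permute_list \<sigma> ` tensor_words n \<subseteq> tensor_words n" using into assms by blast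
  then have "permute_list \<sigma> ` tensor_words n = tensor_words n"
    by (rule endo_inj_surj[OF finite_tensor_words _ inj])
  with inj show ?thesis by (simp add: bij_betw_def)
qed

lemma twos_permute_list:
  assumes "\<sigma> permutes {..<n}" "x \<in> tensor_words n"
  shows "twos n (permute_list \<sigma> x) = \<sigma> -` twos n x"
  using assms permutes_in_image[OF assms(1)]
  by (auto simp: twos_def tensor_words_def permute_list_nth)

lemma card_twos_permute_list:
  assumes "\<sigma> permutes {..<n}" "x \<in> tensor_words n" "y \<in> tensor_words n"
  shows "card (twos n (permute_list \<sigma> x) \<inter> twos n (permute_list \<sigma> y)) = card (twos n x \<inter> twos n y)"
proof -
  have "card (\<sigma> -` (twos n x \<inter> twos n y)) = card (twos n x \<inter> twos n y)"
  proof (rule card_vimage_inj)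
    show "inj \<sigma>" "twos n x \<inter> twos n y \<subseteq> range \<sigma>"
      using permutes_bij[OF assms(1)] by (simp_all add: bij_def)
  qed
  then show ?thesis using assms by (simp add: twos_permute_list)
qed

lemma permute_list_weight_words:
  assumes "\<sigma> permutes {..<l1 + l2}" "x \<in> tensor_words (l1 + l2)"
  shows "permute_list \<sigma> x \<in> weight_words l1 l2 \<longleftrightarrow> x \<in> weight_words l1 l2"
  using assms card_twos_permute_list[OF assms assms(2)] bij_betwE[OF bij_betw_permute_list[OF assms(1)]]
  by (auto simp: weight_words_def)

text \<open>The intersection size determines how many positions carry each pair of letters, so
  \<open>zip x' y'\<close> is a rearrangement of \<open>zip x y\<close>, and one permutation moves
  both words.\<close>

lemma ex_permutation_of_twos:
  assumes x: "x \<in> weight_words l1 l2" "y \<in> weight_words l1 l2"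
    and x': "x' \<in> weight_words l1 l2" "y' \<in> weight_words l1 l2"
    and eq: "card (twos (l1 + l2) x \<inter> twos (l1 + l2) y) = card (twos (l1 + l2) x' \<inter> twos (l1 + l2) y')"
  obtains \<sigma> where "\<sigma> permutes {..<l1 + l2}" "permute_list \<sigma> x = x'" "permute_list \<sigma> y = y'"
proof -
  define n where "n = l1 + l2"
  have cnt: "count (mset (zip x y)) p = (if p = (2, 2) then card (twos n x \<inter> twos n y)
      else if p = (2, 1) \<or> p = (1, 2) then l2 - card (twos n x \<inter> twos n y)
      else if p = (1, 1) then n - (l2 + l2 - card (twos n x \<inter> twos n y)) else 0)"
    if "x \<in> weight_words l1 l2" "y \<in> weight_words l1 l2" for x y p
  proof -
    have w: "x \<in> tensor_words n" "y \<in> tensor_words n" "card (twos n x) = l2" "card (twos n y) = l2"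
      using that by (simp_all add: weight_words_def n_def)
    then have len: "length x = n" "length y = n" by (simp_all add: tensor_words_def)
    have c: "count (mset (zip x y)) p = card {k. k < n \<and> x ! k = fst p \<and> y ! k = snd p}"
      by (auto simp: count_mset length_filter_conv_card count_list_eq_length_filter len prod_eq_iff
          intro!: arg_cong[where f = card])
    have sets: "k < n \<Longrightarrow> x ! k = 1 \<longleftrightarrow> k \<notin> twos n x" "k < n \<Longrightarrow> x ! k = 2 \<longleftrightarrow> k \<in> twos n x"
      "k < n \<Longrightarrow> y ! k = 1 \<longleftrightarrow> k \<notin> twos n y" "k < n \<Longrightarrow> y ! k = 2 \<longleftrightarrow> k \<in> twos n y" for k
      using tensor_words_nth[OF w(1), of k] tensor_words_nth[OF w(2), of k] by (auto simp: twos_def)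
    have lt: "k \<in> twos n x \<Longrightarrow> k < n" "k \<in> twos n y \<Longrightarrow> k < n"
      "k \<in> twos n x \<Longrightarrow> x ! k = 2" "k \<in> twos n y \<Longrightarrow> y ! k = 2" for k by (simp_all add: twos_def)
    have ones: "k \<in> twos n x \<Longrightarrow> k \<notin> twos n y \<Longrightarrow> y ! k = 1"
      "k \<in> twos n y \<Longrightarrow> k \<notin> twos n x \<Longrightarrow> x ! k = 1" for k
      using sets(1,3)[of k] lt(1,2)[of k] by blast+
    consider "p = (2, 2)" | "p = (2, 1)" | "p = (1, 2)" | "p = (1, 1)"
      | "fst p \<notin> {1, 2} \<or> snd p \<notin> {1, 2}"
      by (cases p) auto
    then show ?thesis
    proof cases
      case 1
      have "{k. k < n \<and> x ! k = 2 \<and> y ! k = 2} = twos n x \<inter> twos n y"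
        by (auto simp: twos_def)
      then show ?thesis unfolding c using 1 by simp
    next
      case 2
      have "{k. k < n \<and> x ! k = 2 \<and> y ! k = 1} = twos n x - twos n x \<inter> twos n y"
        by (intro equalityI subsetI) (auto simp: sets simp del: One_nat_def intro: lt ones)
      moreover have "card (twos n x - twos n x \<inter> twos n y) = l2 - card (twos n x \<inter> twos n y)"
        unfolding w(3)[symmetric] by (rule card_Diff_subset) auto
      ultimately show ?thesis unfolding c using 2 by simp
    next
      case 3
      have "{k. k < n \<and> x ! k = 1 \<and> y ! k = 2} = twos n y - twos n x \<inter> twos n y"
        by (intro equalityI subsetI) (auto simp: sets simp del: One_nat_def intro: lt ones)
      moreover have "card (twos n y - twos n x \<inter> twos n y) = l2 - card (twos n x \<inter> twos n y)"
        unfolding w(4)[symmetric] by (rule card_Diff_subset) auto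
      ultimately show ?thesis unfolding c using 3 by simp
    next
      case 4
      have "{k. k < n \<and> x ! k = 1 \<and> y ! k = 1} = {..<n} - (twos n x \<union> twos n y)"
        by (intro equalityI subsetI) (auto simp: sets simp del: One_nat_def intro: lt ones)
      moreover have "card ({..<n} - (twos n x \<union> twos n y)) = card {..<n} - card (twos n x \<union> twos n y)"
        by (rule card_Diff_subset) (use twos_subset in auto)
      moreover have "card (twos n x) + card (twos n y) = card (twos n x \<union> twos n y) + card (twos n x \<inter> twos n y)"
        by (rule card_Un_Int) auto
      then have "card (twos n x \<union> twos n y) = l2 + l2 - card (twos n x \<inter> twos n y)"
        using w(3,4) by linarith
      ultimately show ?thesis unfolding c using 4 by simp
    next
      case 5
      have "\<not> (k < n \<and> x ! k = fst p \<and> y ! k = snd p)" for k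
        using tensor_words_nth[OF w(1), of k] tensor_words_nth[OF w(2), of k] 5 by (metis insertCI)
      then have "{k. k < n \<and> x ! k = fst p \<and> y ! k = snd p} = {}"
        by simp
      then show ?thesis using 5 unfolding c by auto
    qed
  qed
  have "mset (zip x' y') = mset (zip x y)"
    by (rule multiset_eqI) (simp only: cnt[OF x] cnt[OF x'] eq[folded n_def])
  then obtain \<sigma> where \<sigma>: "\<sigma> permutes {..<length (zip x y)}" "permute_list \<sigma> (zip x y) = zip x' y'"
    by (rule mset_eq_permutation)
  have len: "length x = n" "length y = n" "length x' = n" "length y' = n"
    using x x' by (simp_all add: weight_words_def tensor_words_def n_def)
  have "zip (permute_list \<sigma> x) (permute_list \<sigma> y) = zip x' y'"
    using \<sigma> len by (simp add: permute_list_zip)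
  then have "permute_list \<sigma> x = x'" "permute_list \<sigma> y = y'"
    using len by (metis length_permute_list map_fst_zip map_snd_zip)+
  with \<sigma>(1) len show thesis using that by (simp add: n_def)
qed

text \<open>A permutation matrix on the right substitutes in the column index, on the left in the
  row index. Comparing both products at row \<open>permute_list \<sigma> x\<close> gives the
  invariance of entries, and every word has this form.\<close>

lemma commutes_place_perm_iff:
  assumes M: "M \<in> carrier (tensor_End n)" and \<sigma>: "\<sigma> permutes {..<n}"
  shows "M \<otimes>\<^bsub>tensor_End n\<^esub> place_perm n \<sigma> = place_perm n \<sigma> \<otimes>\<^bsub>tensor_End n\<^esub> M \<longleftrightarrow>
    (\<forall>x\<in>tensor_words n. \<forall>y\<in>tensor_words n. M (permute_list \<sigma> x) (permute_list \<sigma> y) = M x y)"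
    (is "?L = ?R \<longleftrightarrow> _")
proof -
  let ?W = "tensor_words n"
  note bij = bij_betw_permute_list[OF \<sigma>]
  have sup: "x \<in> ?W" "y \<in> ?W" if "M x y \<noteq> 0" for x y
    using M that by (auto simp: tensor_End_def)
  have L: "?L x y = (if y \<in> ?W then M x (permute_list \<sigma> y) else 0)" for x y
    using bij_betwE[OF bij]
    by (simp add: tensor_End_def place_perm_def finite_tensor_words if_distrib[of "\<lambda>t. _ * t"] cong: if_cong)
  have R: "?R (permute_list \<sigma> x) y = M x y" if "x \<in> ?W" for x y
  proof -
    have "?R (permute_list \<sigma> x) y = (\<Sum>z\<in>?W. if z = x then M z y else 0)"
      using bij_betw_imp_inj_on[OF bij] that
      by (auto simp: tensor_End_def place_perm_def inj_on_def intro!: sum.cong)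
    then show ?thesis using that by (simp add: finite_tensor_words)
  qed
  have R0: "?R x y = 0" if "x \<notin> ?W" for x y
    using bij_betwE[OF bij] that by (auto simp: tensor_End_def place_perm_def intro!: sum.neutral)
  show ?thesis
  proof
    assume "?L = ?R"
    then show "\<forall>x\<in>?W. \<forall>y\<in>?W. M (permute_list \<sigma> x) (permute_list \<sigma> y) = M x y"
      using L R by metis
  next
    assume *: "\<forall>x\<in>?W. \<forall>y\<in>?W. M (permute_list \<sigma> x) (permute_list \<sigma> y) = M x y"
    show "?L = ?R"
    proof (intro ext)
      fix x y
      show "?L x y = ?R x y"
      proof (cases "x \<in> ?W")
        case False
        then show ?thesis using L R0 sup by metis
      next
        case True
        then obtain z where "z \<in> ?W" "x = permute_list \<sigma> z"
          using bij_betw_imp_surj_on[OF bij] by blast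
        then show ?thesis using L R * sup by metis
      qed
    qed
  qed
qed

text \<open>Commuting with all place permutations makes the entries constant on orbits of pairs,
  which the intersection size separates; the sandwich by \<open>weight_idem\<close> cuts down to
  words of weight \<lambda>.\<close>

lemma carrier_S:
  "carrier (schur_weight_algebra l1 l2) = range (orbit_endo l1 l2 :: (nat \<Rightarrow> 'k::comm_ring_1) \<Rightarrow> _)"
proof (intro equalityI subsetI)
  let ?n = "l1 + l2" and ?W = "tensor_words (l1 + l2)" and ?V = "weight_words l1 l2"
  let ?c = "\<lambda>x y. card (twos ?n x \<inter> twos ?n y)"
  {
    fix A :: "'k endo" assume "A \<in> carrier (schur_weight_algebra l1 l2)"
    then obtain M where M: "M \<in> carrier (schur_algebra ?n)"
      and A: "A = (\<lambda>x y. if x \<in> ?V \<and> y \<in> ?V then M x y else 0)"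
      unfolding schur_weight_algebra_def by (auto simp: weight_idem_sandwich)
    have inv: "M (permute_list \<sigma> x) (permute_list \<sigma> y) = M x y"
      if "\<sigma> permutes {..<?n}" "x \<in> ?W" "y \<in> ?W" for \<sigma> x y
      using M that commutes_place_perm_iff[of M ?n \<sigma>] by (auto simp: schur_algebra_def)
    have same: "M x y = M x' y'"
      if xy: "x \<in> ?V" "y \<in> ?V" "x' \<in> ?V" "y' \<in> ?V" "?c x y = ?c x' y'" for x y x' y'
    proof -
      obtain \<sigma> where "\<sigma> permutes {..<?n}" "permute_list \<sigma> x = x'" "permute_list \<sigma> y = y'"
        by (rule ex_permutation_of_twos[OF xy])
      then have "M x' y' = M (permute_list \<sigma> x) (permute_list \<sigma> y)" by simp
      also have "\<dots> = M x y"
        using \<open>\<sigma> permutes _\<close> xy weight_words_subset by (intro inv) auto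
      finally show ?thesis ..
    qed
    \<comment> \<open>The value at \<open>s\<close> is read off at a chosen pair with intersection
      size \<open>s\<close>; by \<open>same\<close> the choice does not matter. At sizes that do not
      occur the value is arbitrary.\<close>
    define \<phi> where "\<phi> s = (let p = SOME p. fst p \<in> ?V \<and> snd p \<in> ?V \<and> ?c (fst p) (snd p) = s
      in M (fst p) (snd p))" for s
    have "\<phi> (?c x y) = M x y" if "x \<in> ?V" "y \<in> ?V" for x y
    proof -
      define p where "p = (SOME p. fst p \<in> ?V \<and> snd p \<in> ?V \<and> ?c (fst p) (snd p) = ?c x y)"
      have "\<exists>p. fst p \<in> ?V \<and> snd p \<in> ?V \<and> ?c (fst p) (snd p) = ?c x y"
        using that by (intro exI[of _ "(x, y)"]) simp
      then have p: "fst p \<in> ?V \<and> snd p \<in> ?V \<and> ?c (fst p) (snd p) = ?c x y"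
        unfolding p_def by (rule someI_ex)
      have "\<phi> (?c x y) = M (fst p) (snd p)" unfolding \<phi>_def p_def by (simp only: Let_def)
      also have "\<dots> = M x y" using p that by (intro same) simp_all
      finally show ?thesis .
    qed
    then have "A = orbit_endo l1 l2 \<phi>" by (intro ext) (simp add: A orbit_endo_def)
    then show "A \<in> range (orbit_endo l1 l2)" by blast
  next
    fix A :: "'k endo" assume "A \<in> range (orbit_endo l1 l2)"
    then obtain \<phi> where A: "A = orbit_endo l1 l2 \<phi>" by blast
    have T: "A \<in> carrier (tensor_End ?n)"
      using weight_words_subset by (auto simp: tensor_End_def A orbit_endo_def split: if_splits)
    have "A \<in> carrier (schur_algebra ?n)"
      using T commutes_place_perm_iff[OF T]
      by (simp add: schur_algebra_def A orbit_endo_def card_twos_permute_list permute_list_weight_words)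
    moreover have "A = weight_idem l1 l2 \<otimes>\<^bsub>schur_algebra ?n\<^esub> A \<otimes>\<^bsub>schur_algebra ?n\<^esub> weight_idem l1 l2"
      unfolding weight_idem_sandwich by (intro ext) (simp add: A orbit_endo_def)
    ultimately show "A \<in> carrier (schur_weight_algebra l1 l2)"
      unfolding schur_weight_algebra_def by auto
  }
qed

section \<open>Products in S(\<lambda>) and its commutative ring structure\<close>

lemma orbit_endo_mult:
  assumes "x \<in> weight_words l1 l2" "y \<in> weight_words l1 l2"
  shows "(orbit_endo l1 l2 \<phi> \<otimes>\<^bsub>schur_weight_algebra l1 l2\<^esub> orbit_endo l1 l2 \<psi>) x y =
    (\<Sum>Z\<in>{Z. Z \<subseteq> {..<l1 + l2} \<and> card Z = l2}.
      \<phi> (card (twos (l1 + l2) x \<inter> Z)) * \<psi> (card (Z \<inter> twos (l1 + l2) y)) :: 'k::comm_ring_1)"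
proof -
  let ?f = "\<lambda>Z. \<phi> (card (twos (l1 + l2) x \<inter> Z)) * \<psi> (card (Z \<inter> twos (l1 + l2) y))"
  have "(orbit_endo l1 l2 \<phi> \<otimes>\<^bsub>schur_weight_algebra l1 l2\<^esub> orbit_endo l1 l2 \<psi>) x y =
      (\<Sum>z\<in>weight_words l1 l2. orbit_endo l1 l2 \<phi> x z * orbit_endo l1 l2 \<psi> z y)"
    unfolding S_mult by (rule sum_words_restrict) (simp add: orbit_endo_def)
  also have "\<dots> = (\<Sum>z\<in>weight_words l1 l2. ?f (twos (l1 + l2) z))"
    using assms by (intro sum.cong) (simp_all add: orbit_endo_def)
  also have "\<dots> = (\<Sum>Z\<in>{Z. Z \<subseteq> {..<l1 + l2} \<and> card Z = l2}. ?f Z)"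
    by (rule sum.reindex_bij_betw[OF bij_betw_twos_weight])
  finally show ?thesis .
qed

lemma S_mult_closed:
  assumes "A \<in> carrier (schur_weight_algebra l1 l2)" "B \<in> carrier (schur_weight_algebra l1 l2)"
  shows "A \<otimes>\<^bsub>schur_weight_algebra l1 l2\<^esub> B \<in> carrier (schur_weight_algebra l1 l2 :: 'k::comm_ring_1 endo ring)"
proof -
  let ?n = "l1 + l2" and ?W = "tensor_words (l1 + l2)"
  let ?S = "schur_weight_algebra l1 l2 :: 'k endo ring" and ?T = "tensor_End ?n :: 'k endo ring"
  have AB: "A \<otimes>\<^bsub>?S\<^esub> B = A \<otimes>\<^bsub>?T\<^esub> B" unfolding S_mult by (simp add: tensor_End_def)
  obtain \<phi> \<psi> where A: "A = orbit_endo l1 l2 \<phi>" and B: "B = orbit_endo l1 l2 \<psi>"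
    using assms unfolding carrier_S by blast
  have AB0: "(A \<otimes>\<^bsub>?T\<^esub> B) x y = 0" if "x \<notin> weight_words l1 l2 \<or> y \<notin> weight_words l1 l2" for x y
    using that by (auto simp: tensor_End_def A B orbit_endo_def)
  have T: "A \<otimes>\<^bsub>?T\<^esub> B \<in> carrier ?T"
    using AB0 weight_words_subset by (fastforce simp: tensor_End_def)
  have inv: "A (permute_list \<sigma> x) (permute_list \<sigma> y) = A x y"
      "B (permute_list \<sigma> x) (permute_list \<sigma> y) = B x y"
    if "\<sigma> permutes {..<?n}" "x \<in> ?W" "y \<in> ?W" for \<sigma> x y
    using that by (simp_all add: A B orbit_endo_def card_twos_permute_list permute_list_weight_words)
  have "(A \<otimes>\<^bsub>?T\<^esub> B) (permute_list \<sigma> x) (permute_list \<sigma> y) = (A \<otimes>\<^bsub>?T\<^esub> B) x y"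
    if *: "\<sigma> permutes {..<?n}" "x \<in> ?W" "y \<in> ?W" for \<sigma> x y
  proof -
    have "(\<Sum>z\<in>?W. A (permute_list \<sigma> x) z * B z (permute_list \<sigma> y)) =
        (\<Sum>z\<in>?W. A (permute_list \<sigma> x) (permute_list \<sigma> z) * B (permute_list \<sigma> z) (permute_list \<sigma> y))"
      by (rule sum.reindex_bij_betw[OF bij_betw_permute_list[OF *(1)], symmetric])
    also have "\<dots> = (\<Sum>z\<in>?W. A x z * B z y)"
      by (intro sum.cong) (simp_all add: inv *)
    finally show ?thesis by (simp add: tensor_End_def)
  qed
  then have "A \<otimes>\<^bsub>?T\<^esub> B \<in> carrier (schur_algebra ?n)"
    using T by (simp add: schur_algebra_def commutes_place_perm_iff)
  moreover have "A \<otimes>\<^bsub>?T\<^esub> B = weight_idem l1 l2 \<otimes>\<^bsub>schur_algebra ?n\<^esub> (A \<otimes>\<^bsub>?T\<^esub> B)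
      \<otimes>\<^bsub>schur_algebra ?n\<^esub> weight_idem l1 l2"
    unfolding weight_idem_sandwich using AB0 by (intro ext) auto
  ultimately show ?thesis unfolding AB unfolding schur_weight_algebra_def by auto
qed

lemma weight_idem_in_S:
  "weight_idem l1 l2 \<in> carrier (schur_weight_algebra l1 l2 :: 'k::comm_ring_1 endo ring)"
proof -
  have "weight_idem l1 l2 = (orbit_endo l1 l2 (\<lambda>s. if s = l2 then 1 else 0) :: 'k endo)"
  proof (intro ext)
    fix x y
    show "weight_idem l1 l2 x y = (orbit_endo l1 l2 (\<lambda>s. if s = l2 then 1 else 0) :: 'k endo) x y"
    proof (cases "x \<in> weight_words l1 l2 \<and> y \<in> weight_words l1 l2")
      case True
      let ?X = "twos (l1 + l2) x" and ?Y = "twos (l1 + l2) y"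
      have c: "card ?X = l2" "card ?Y = l2" using True by (simp_all add: weight_words_def)
      have "card (?X \<inter> ?Y) = l2 \<longleftrightarrow> ?X = ?Y"
        using card_subset_eq[of ?X "?X \<inter> ?Y"] card_subset_eq[of ?Y "?X \<inter> ?Y"] c by auto
      then show ?thesis
        using True weight_words_subset[of l1 l2]
        by (auto simp: weight_idem_eq orbit_endo_def twos_eq_iff subset_eq)
    qed (auto simp: weight_idem_eq orbit_endo_def)
  qed
  then show ?thesis by (simp add: carrier_S)
qed

text \<open>All elements are symmetric matrices, so transposing a product exchanges the factors.\<close>

lemma S_comm:
  assumes "A \<in> carrier (schur_weight_algebra l1 l2)" "B \<in> carrier (schur_weight_algebra l1 l2)"
  shows "A \<otimes>\<^bsub>schur_weight_algebra l1 l2\<^esub> B =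
    B \<otimes>\<^bsub>schur_weight_algebra l1 l2 :: 'k::comm_ring_1 endo ring\<^esub> A"
proof (intro ext)
  fix x y
  have sym: "C x y = C y x" if "C \<in> carrier (schur_weight_algebra l1 l2)" for C :: "'k endo" and x y
    using that by (auto simp: carrier_S orbit_endo_def Int_commute)
  have "(A \<otimes>\<^bsub>schur_weight_algebra l1 l2\<^esub> B) x y = (A \<otimes>\<^bsub>schur_weight_algebra l1 l2\<^esub> B) y x"
    by (rule sym[OF S_mult_closed[OF assms]])
  also have "\<dots> = (\<Sum>z\<in>tensor_words (l1 + l2). B x z * A z y)"
    unfolding S_mult using sym[OF assms(1)] sym[OF assms(2)]
    by (intro sum.cong refl) (metis mult.commute)
  finally show "(A \<otimes>\<^bsub>schur_weight_algebra l1 l2\<^esub> B) x y = (B \<otimes>\<^bsub>schur_weight_algebra l1 l2\<^esub> A) x y"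
    by (simp only: S_mult)
qed

lemma S_mult_assoc:
  "(A \<otimes>\<^bsub>schur_weight_algebra l1 l2\<^esub> B) \<otimes>\<^bsub>schur_weight_algebra l1 l2\<^esub> C =
    A \<otimes>\<^bsub>schur_weight_algebra l1 l2 :: 'k::comm_ring_1 endo ring\<^esub> (B \<otimes>\<^bsub>schur_weight_algebra l1 l2\<^esub> C)"
  unfolding S_mult
  by (intro ext, simp add: sum_distrib_left sum_distrib_right, subst sum.swap) (simp add: mult.assoc)

lemma orbit_endo_add: "(\<lambda>x y. orbit_endo l1 l2 \<phi> x y + orbit_endo l1 l2 \<psi> x y) =
    orbit_endo l1 l2 (\<lambda>s. \<phi> s + \<psi> s)"
  by (intro ext) (simp add: orbit_endo_def)

lemma cring_S: "cring (schur_weight_algebra l1 l2 :: 'k::comm_ring_1 endo ring)"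
    (is "cring ?S")
proof (rule cringI)
  show "abelian_group ?S"
  proof (rule abelian_groupI)
    fix A B assume "A \<in> carrier ?S" "B \<in> carrier ?S"
    then show "A \<oplus>\<^bsub>?S\<^esub> B \<in> carrier ?S"
      by (auto simp: carrier_S S_add orbit_endo_add)
  next
    have "(\<lambda>x y. 0) = (orbit_endo l1 l2 (\<lambda>_. 0) :: 'k endo)"
      by (intro ext) (simp add: orbit_endo_def)
    then show "\<zero>\<^bsub>?S\<^esub> \<in> carrier ?S" by (simp add: carrier_S S_zero)
  next
    fix A assume "A \<in> carrier ?S"
    then obtain \<phi> where "A = orbit_endo l1 l2 \<phi>" unfolding carrier_S by blast
    then have "orbit_endo l1 l2 (\<lambda>s. - \<phi> s) \<oplus>\<^bsub>?S\<^esub> A = \<zero>\<^bsub>?S\<^esub>"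
      unfolding S_add S_zero by (intro ext) (simp add: orbit_endo_def)
    then show "\<exists>B\<in>carrier ?S. B \<oplus>\<^bsub>?S\<^esub> A = \<zero>\<^bsub>?S\<^esub>" unfolding carrier_S by blast
  qed (simp_all add: S_add S_zero add_ac)
  show "comm_monoid ?S"
  proof (rule comm_monoidI)
    show "\<one>\<^bsub>?S\<^esub> \<in> carrier ?S" by (simp add: S_one weight_idem_in_S)
    show "\<one>\<^bsub>?S\<^esub> \<otimes>\<^bsub>?S\<^esub> A = A" if A: "A \<in> carrier ?S" for A
    proof -
      obtain \<phi> where "A = orbit_endo l1 l2 \<phi>" using A unfolding carrier_S by blast
      then show ?thesis unfolding S_one S_mult weight_idem_mult_left
        by (intro ext) (simp add: orbit_endo_def)
    qed
  qed (simp_all add: S_mult_closed S_mult_assoc S_comm)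
  show "(A \<oplus>\<^bsub>?S\<^esub> B) \<otimes>\<^bsub>?S\<^esub> C = (A \<otimes>\<^bsub>?S\<^esub> C) \<oplus>\<^bsub>?S\<^esub> (B \<otimes>\<^bsub>?S\<^esub> C)" for A B C
    by (simp add: S_add S_mult distrib_right sum.distrib)
qed

subsection \<open>The elements \<open>b(i)\<close>\<close>

text \<open>For \<open>i > l2\<close> truncated subtraction would turn the binomial coefficient into
  1, whereas b(i) = 0; hence the case distinction.\<close>

definition b_value :: "nat \<Rightarrow> nat \<Rightarrow> nat \<Rightarrow> nat" where
  "b_value l2 i s = (if i \<le> l2 then s choose (l2 - i) else 0)"

lemma changed_iff:
  assumes "x \<in> tensor_words n" "z \<in> tensor_words n"
  shows "changed n 2 1 i x z \<longleftrightarrow> twos n z \<subseteq> twos n x \<and> card (twos n x - twos n z) = i"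
    and "changed n 1 2 i z x \<longleftrightarrow> twos n z \<subseteq> twos n x \<and> card (twos n x - twos n z) = i"
proof -
  have w: "x ! k = 1 \<or> x ! k = 2" "z ! k = 1 \<or> z ! k = 2" if "k < n" for k
    using tensor_words_nth assms that by blast+
  have pt: "(z ! k = 2 \<longrightarrow> x ! k = 2) \<longleftrightarrow> x ! k = z ! k \<or> x ! k = 2 \<and> z ! k = 1" if "k < n" for k
    using w[OF that] by auto
  have sub: "twos n z \<subseteq> twos n x \<longleftrightarrow> (\<forall>k<n. z ! k = 2 \<longrightarrow> x ! k = 2)"
    by (auto simp: twos_def)
  have l: "(\<forall>k<n. x ! k = z ! k \<or> x ! k = 2 \<and> z ! k = 1) \<longleftrightarrow> twos n z \<subseteq> twos n x"
    unfolding sub using pt by blast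
  have r: "(\<forall>k<n. z ! k = x ! k \<or> z ! k = 1 \<and> x ! k = 2) \<longleftrightarrow> twos n z \<subseteq> twos n x"
    unfolding l[symmetric] by (simp add: eq_commute conj_commute)
  have diff: "{k. k < n \<and> x ! k \<noteq> z ! k} = twos n x - twos n z" if "twos n z \<subseteq> twos n x"
  proof -
    have "x ! k \<noteq> z ! k \<longleftrightarrow> x ! k = 2 \<and> z ! k \<noteq> 2" if "k < n" for k
      using w[OF that] \<open>twos n z \<subseteq> twos n x\<close> that unfolding sub by auto
    then show ?thesis by (auto simp: twos_def)
  qed
  have diff': "{k. k < n \<and> z ! k \<noteq> x ! k} = twos n x - twos n z" if "twos n z \<subseteq> twos n x"
    unfolding diff[OF that, symmetric] by auto
  show "changed n 2 1 i x z \<longleftrightarrow> twos n z \<subseteq> twos n x \<and> card (twos n x - twos n z) = i"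
    unfolding changed_def l using assms diff by auto
  show "changed n 1 2 i z x \<longleftrightarrow> twos n z \<subseteq> twos n x \<and> card (twos n x - twos n z) = i"
    unfolding changed_def r using assms diff' by auto
qed

text \<open>On the way from \<open>y\<close> to \<open>x\<close>, e^(i) changes i letters 2 into 1
  and f^(i) then changes i letters 1 into 2. The entry counts the words in between, that is, the
  sets of size l2 - i contained in both sets of twos.\<close>

lemma b_rat_eq: "b_rat l1 l2 i = orbit_endo l1 l2 (\<lambda>s. of_nat (b_value l2 i s))"
proof (intro ext)
  fix x y
  let ?n = "l1 + l2"
  show "b_rat l1 l2 i x y = orbit_endo l1 l2 (\<lambda>s. of_nat (b_value l2 i s)) x y"
  proof (cases "x \<in> weight_words l1 l2 \<and> y \<in> weight_words l1 l2")
    case False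
    then show ?thesis
      by (auto simp: b_rat_def tensor_End_def weight_idem_mult_right weight_idem_mult_left orbit_endo_def)
  next
    case True
    let ?X = "twos ?n x" and ?Y = "twos ?n y"
    have xy: "x \<in> tensor_words ?n" "y \<in> tensor_words ?n" and c: "card ?X = l2" "card ?Y = l2"
      using True by (simp_all add: weight_words_def)
    let ?P = "\<lambda>Z. Z \<subseteq> ?X \<and> card (?X - Z) = i \<and> Z \<subseteq> ?Y \<and> card (?Y - Z) = i"
    have "b_rat l1 l2 i x y =
        (\<Sum>z\<in>tensor_words ?n. if changed ?n 2 1 i x z \<and> changed ?n 1 2 i z y then 1 else 0)"
      using True
      by (auto simp: b_rat_def tensor_End_def weight_idem_mult_right weight_idem_mult_left divided_power_eq
          intro!: sum.cong)
    also have "\<dots> = (\<Sum>z\<in>tensor_words ?n. if ?P (twos ?n z) then 1 else 0)"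
      by (intro sum.cong refl) (simp only: changed_iff(1)[OF xy(1)] changed_iff(2)[OF xy(2)] conj_assoc)
    also have "\<dots> = (\<Sum>Z\<in>Pow {..<?n}. if ?P Z then 1 else 0)"
      by (rule sum.reindex_bij_betw[OF bij_betw_twos])
    also have "\<dots> = of_nat (card {Z \<in> Pow {..<?n}. ?P Z})"
      by (simp flip: sum.inter_filter)
    also have "{Z \<in> Pow {..<?n}. ?P Z} = {Z. Z \<subseteq> ?X \<inter> ?Y \<and> i \<le> l2 \<and> card Z = l2 - i}"
    proof -
      have "card (?X - Z) = l2 - card Z \<and> card (?Y - Z) = l2 - card Z \<and> card Z \<le> l2"
        if "Z \<subseteq> ?X \<inter> ?Y" for Z
      proof -
        have "Z \<subseteq> ?X" "Z \<subseteq> ?Y" using that by auto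
        then show ?thesis
          using card_Diff_subset[of Z] card_mono[of ?X Z] c by (simp add: finite_subset[of Z ?X])
      qed
      then have "?P Z \<longleftrightarrow> Z \<subseteq> ?X \<inter> ?Y \<and> i \<le> l2 \<and> card Z = l2 - i" for Z by auto
      then show ?thesis using twos_subset[of ?n x] by auto
    qed
    also have "card \<dots> = b_value l2 i (card (?X \<inter> ?Y))"
      using n_subsets[of "?X \<inter> ?Y" "l2 - i"] by (simp add: b_value_def del: Int_subset_iff)
    finally show ?thesis using True by (simp add: orbit_endo_def)
  qed
qed

lemma b_el_eq: "b_el l1 l2 i = (orbit_endo l1 l2 (\<lambda>s. of_nat (b_value l2 i s)) :: 'k::comm_ring_1 endo)"
  by (intro ext) (simp add: b_el_def b_rat_eq orbit_endo_def)

lemma b_el_in_S: "b_el l1 l2 i \<in> carrier (schur_weight_algebra l1 l2 :: 'k::comm_ring_1 endo ring)"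
  by (simp add: b_el_eq carrier_S)

lemma b_el_0: "b_el l1 l2 0 = (weight_idem l1 l2 :: 'k::comm_ring_1 endo)"
proof (intro ext)
  fix x y
  show "b_el l1 l2 0 x y = (weight_idem l1 l2 :: 'k endo) x y"
  proof (cases "x \<in> weight_words l1 l2 \<and> y \<in> weight_words l1 l2")
    case True
    let ?X = "twos (l1 + l2) x" and ?Y = "twos (l1 + l2) y"
    have c: "card ?X = l2" "card ?Y = l2" using True by (simp_all add: weight_words_def)
    have le: "card (?X \<inter> ?Y) \<le> l2" using card_mono[of ?X "?X \<inter> ?Y"] c by simp
    have "card (?X \<inter> ?Y) = l2 \<longleftrightarrow> ?X = ?Y"
      using card_subset_eq[of ?X "?X \<inter> ?Y"] card_subset_eq[of ?Y "?X \<inter> ?Y"] c by auto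
    also have "\<dots> \<longleftrightarrow> x = y"
      using True by (intro twos_eq_iff) (simp_all add: weight_words_def)
    finally have "card (?X \<inter> ?Y) choose l2 = of_bool (x = y)"
      using le by (cases "x = y") (simp_all add: binomial_eq_0)
    then show ?thesis using True
      by (simp add: b_el_eq orbit_endo_def weight_idem_eq b_value_def)
  qed (auto simp: b_el_eq orbit_endo_def weight_idem_eq)
qed

lemma b_el_eq_0: "l2 < i \<Longrightarrow> b_el l1 l2 i = (\<lambda>x y. 0 :: 'k::comm_ring_1)"
  by (simp add: b_el_eq orbit_endo_def b_value_def)

subsection \<open>Structure constants\<close>

text \<open>A subset of \<open>V \<inter> Z\<close> with l - 1 elements is \<open>V\<close> with one
  point deleted. In this form the entries of b(1) can be summed point by point.\<close>

lemma choose_pred_card_Int: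
  assumes "finite V" "finite Z" "card V = l" "card Z = l" "0 < l"
  shows "card (V \<inter> Z) choose (l - 1) = card {p \<in> V. V - {p} \<subseteq> Z}"
proof -
  have split: "card (V \<inter> Z) + card (V - Z) = l"
    using card_Int_Diff[OF assms(1), of Z] assms by simp
  consider "card (V - Z) = 0" | "card (V - Z) = 1" | "card (V - Z) \<ge> 2" by linarith
  then show ?thesis
  proof cases
    case 1
    then have "V - Z = {}" using assms(1) by simp
    then have "V \<inter> Z = V" "{p \<in> V. V - {p} \<subseteq> Z} = V" by auto
    then show ?thesis using assms binomial_symmetric[of 1 l] by simp
  next
    case 2
    then obtain q where "V - Z = {q}" by (rule card_1_singletonE)
    then have "{p \<in> V. V - {p} \<subseteq> Z} = {q}" by auto
    moreover have "card (V \<inter> Z) = l - 1" using 2 split by simp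
    ultimately show ?thesis by simp
  next
    case 3
    have "{p \<in> V. V - {p} \<subseteq> Z} = {}"
    proof (rule ccontr)
      assume "{p \<in> V. V - {p} \<subseteq> Z} \<noteq> {}"
      then obtain p where "V - Z \<subseteq> {p}" by auto
      then have "card (V - Z) \<le> 1" using card_mono[of "{p}" "V - Z"] by simp
      then show False using 3 by simp
    qed
    moreover have "card (V \<inter> Z) choose (l - 1) = 0"
      using 3 split by (simp add: binomial_eq_0)
    ultimately show ?thesis by (simp only: card.empty)
  qed
qed

text \<open>Each \<open>Z\<close> adds one point to \<open>A\<close>. Of the points outside
  \<open>A\<close>, l - t lie in \<open>Y\<close> and raise the intersection size; the other m + 2l
  - (2l - 1 - t) = m + 1 + t leave it at \<open>t\<close>.\<close>

lemma sum_insert_fibre: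
  fixes f :: "nat \<Rightarrow> int"
  assumes U: "finite U" "A \<subseteq> U" "Y \<subseteq> U" and A: "card A = l - 1" and Y: "card Y = l"
    and l: "0 < l" and n: "card U = m + 2 * l" and t: "card (A \<inter> Y) = t"
  shows "(\<Sum>Z | Z \<subseteq> U \<and> card Z = l \<and> A \<subseteq> Z. f (card (Z \<inter> Y))) =
    (int l - int t) * f (Suc t) + (int m + 1 + int t) * f t"
proof -
  have fin: "finite A" "finite Y" using U finite_subset by blast+
  have bij: "bij_betw (\<lambda>c. insert c A) (U - A) {Z. Z \<subseteq> U \<and> card Z = l \<and> A \<subseteq> Z}"
  proof (rule bij_betw_imageI)
    show "inj_on (\<lambda>c. insert c A) (U - A)" by (auto simp: inj_on_def)
    show "(\<lambda>c. insert c A) ` (U - A) = {Z. Z \<subseteq> U \<and> card Z = l \<and> A \<subseteq> Z}"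
    proof (intro equalityI subsetI)
      fix Z assume "Z \<in> (\<lambda>c. insert c A) ` (U - A)"
      then show "Z \<in> {Z. Z \<subseteq> U \<and> card Z = l \<and> A \<subseteq> Z}" using U fin A l by auto
    next
      fix Z assume Z: "Z \<in> {Z. Z \<subseteq> U \<and> card Z = l \<and> A \<subseteq> Z}"
      then have "card (Z - A) = 1" using fin A l by (simp add: card_Diff_subset)
      then obtain c where "Z - A = {c}" by (rule card_1_singletonE)
      then have "Z = insert c A" "c \<in> U - A" using Z by auto
      then show "Z \<in> (\<lambda>c. insert c A) ` (U - A)" by blast
    qed
  qed
  have "(\<Sum>Z | Z \<subseteq> U \<and> card Z = l \<and> A \<subseteq> Z. f (card (Z \<inter> Y))) = (\<Sum>c\<in>U - A. f (card (insert c A \<inter> Y)))"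
    by (rule sum.reindex_bij_betw[OF bij, symmetric])
  also have "\<dots> = (\<Sum>c\<in>U - A. if c \<in> Y then f (Suc t) else f t)"
    using fin t by (intro sum.cong refl) auto
  also have "\<dots> = (\<Sum>c\<in>(U - A) \<inter> Y. f (Suc t)) + (\<Sum>c\<in>(U - A) \<inter> - Y. f t)"
    using U by (subst sum.If_cases) auto
  also have "(U - A) \<inter> Y = Y - A \<inter> Y" using U by auto
  also have "(U - A) \<inter> - Y = U - (A \<union> Y)" by auto
  also have "(\<Sum>c\<in>Y - A \<inter> Y. f (Suc t)) + (\<Sum>c\<in>U - (A \<union> Y). f t) =
      int (card (Y - A \<inter> Y)) * f (Suc t) + int (card (U - (A \<union> Y))) * f t" by simp
  also have "int (card (Y - A \<inter> Y)) = int l - int t"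
  proof -
    have "card (Y - A \<inter> Y) = card Y - card (A \<inter> Y)" "card (A \<inter> Y) \<le> card Y"
      using fin by (auto intro: card_Diff_subset card_mono)
    then show ?thesis using Y t by simp
  qed
  also have "int (card (U - (A \<union> Y))) = int m + 1 + int t"
  proof -
    have "card (U - (A \<union> Y)) = card U - card (A \<union> Y)" "card (A \<union> Y) \<le> card U"
      using U fin by (auto intro!: card_Diff_subset card_mono)
    moreover have "card A + card Y = card (A \<union> Y) + card (A \<inter> Y)"
      using fin by (rule card_Un_Int)
    ultimately show ?thesis using A Y t n l by simp
  qed
  finally show ?thesis .
qed

text \<open>One step of the walk behind b(1): delete a point \<open>p\<close> of \<open>V\<close>,
  then insert a point. For the s points \<open>p\<close> in \<open>Y\<close> the fibre has t = s -
  1, for the other l - s it has t = s.\<close>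

lemma sum_choose_pred:
  fixes f :: "nat \<Rightarrow> int"
  assumes U: "finite U" "V \<subseteq> U" "Y \<subseteq> U" and V: "card V = l" and Y: "card Y = l"
    and l: "0 < l" and n: "card U = m + 2 * l" and s: "card (V \<inter> Y) = s"
  shows "(\<Sum>Z\<in>{Z. Z \<subseteq> U \<and> card Z = l}. int (card (V \<inter> Z) choose (l - 1)) * f (card (Z \<inter> Y))) =
    (int s * (int l - int s + 1) + (int l - int s) * (int m + 1 + int s)) * f s
      + int s * (int m + int s) * f (s - 1) + (int l - int s)\<^sup>2 * f (Suc s)"
proof -
  let ?L = "{Z. Z \<subseteq> U \<and> card Z = l}"
  have fin: "finite V" "finite Y" "finite ?L" using U finite_subset by auto
  have "(\<Sum>Z\<in>?L. int (card (V \<inter> Z) choose (l - 1)) * f (card (Z \<inter> Y))) =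
      (\<Sum>Z\<in>?L. \<Sum>p | p \<in> V \<and> V - {p} \<subseteq> Z. f (card (Z \<inter> Y)))"
  proof (intro sum.cong refl)
    fix Z assume "Z \<in> ?L"
    then have "card (V \<inter> Z) choose (l - 1) = card {p \<in> V. V - {p} \<subseteq> Z}"
      using fin V l U by (intro choose_pred_card_Int) (auto intro: finite_subset)
    then show "int (card (V \<inter> Z) choose (l - 1)) * f (card (Z \<inter> Y)) =
        (\<Sum>p | p \<in> V \<and> V - {p} \<subseteq> Z. f (card (Z \<inter> Y)))" by simp
  qed
  also have "\<dots> = (\<Sum>p\<in>V. \<Sum>Z | Z \<in> ?L \<and> V - {p} \<subseteq> Z. f (card (Z \<inter> Y)))"
    using fin by (intro sum.swap_restrict) auto
  also have "\<dots> = (\<Sum>p\<in>V. if p \<in> Y then (int l - int s + 1) * f s + (int m + int s) * f (s - 1)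
      else (int l - int s) * f (Suc s) + (int m + 1 + int s) * f s)"
  proof (intro sum.cong refl)
    fix p assume p: "p \<in> V"
    have cA: "card (V - {p}) = l - 1" using p V fin by simp
    have eq: "(\<Sum>Z | Z \<in> ?L \<and> V - {p} \<subseteq> Z. f (card (Z \<inter> Y))) =
        (\<Sum>Z | Z \<subseteq> U \<and> card Z = l \<and> V - {p} \<subseteq> Z. f (card (Z \<inter> Y)))"
      by (rule sum.cong) auto
    have "V - {p} \<subseteq> U" using U(2) by auto
    note fibre = sum_insert_fibre[OF U(1) this U(3) cA Y l n, of _ f]
    show "(\<Sum>Z | Z \<in> ?L \<and> V - {p} \<subseteq> Z. f (card (Z \<inter> Y))) =
      (if p \<in> Y then (int l - int s + 1) * f s + (int m + int s) * f (s - 1)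
      else (int l - int s) * f (Suc s) + (int m + 1 + int s) * f s)"
    proof (cases "p \<in> Y")
      case True
      then have "(V - {p}) \<inter> Y = (V \<inter> Y) - {p}" "p \<in> V \<inter> Y" using p by auto
      \<comment> \<open>The point \<open>p\<close> itself shows \<open>0 < s\<close>, so
        \<open>s - 1\<close> is a true predecessor.\<close>
      then have c: "card ((V - {p}) \<inter> Y) = s - 1" and "0 < s"
        using s fin card_gt_0_iff[of "V \<inter> Y"] by auto
      then have "Suc (s - 1) = s" "int (s - 1) = int s - 1" by simp_all
      then show ?thesis unfolding eq fibre[OF c] using True by (simp add: algebra_simps)
    next
      case False
      then have "(V - {p}) \<inter> Y = V \<inter> Y" by auto
      then have c: "card ((V - {p}) \<inter> Y) = s" using s by simp
      show ?thesis unfolding eq fibre[OF c] using False by simp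
    qed
  qed
  also have "\<dots> = int (card (V \<inter> Y)) * ((int l - int s + 1) * f s + (int m + int s) * f (s - 1)) +
      int (card (V \<inter> - Y)) * ((int l - int s) * f (Suc s) + (int m + 1 + int s) * f s)"
    using fin by (subst sum.If_cases) auto
  also have "int (card (V \<inter> - Y)) = int l - int s"
  proof -
    have "card (V \<inter> Y) + card (V - Y) = l" using card_Int_Diff[OF fin(1), of Y] V by simp
    moreover have "V - Y = V \<inter> - Y" by auto
    ultimately show ?thesis using s by simp
  qed
  finally show ?thesis unfolding s by (simp add: algebra_simps power2_eq_square)
qed

text \<open>With q = l - i - 1, Pascal's rule and absorption express all values of \<open>f\<close>
  through A = C(s, q+1) and B = C(s, q), which are tied by (s - q) B = (q + 1) A. For i = l, where
  no such q exists, \<open>f\<close> is constantly 1.\<close>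

lemma b_value_recurrence:
  assumes s: "s \<le> l" and i: "i \<le> l"
  defines "f \<equiv> \<lambda>s. int (s choose (l - i))"
  shows "(int s * (int l - int s + 1) + (int l - int s) * (int m + 1 + int s)) * f s
      + int s * (int m + int s) * f (s - 1) + (int l - int s)\<^sup>2 * f (Suc s) =
    (int i + 1)\<^sup>2 * int (b_value l (Suc i) s) + int i * (int m + int i + 1) * int (b_value l i s)"
proof (cases "i = l")
  case True
  then show ?thesis by (simp add: f_def b_value_def algebra_simps power2_eq_square)
next
  case False
  then obtain q where q: "l - i = Suc q" "l - Suc i = q" "l = i + Suc q" "Suc i \<le> l"
    using i by (metis Suc_diff_Suc diff_diff_cancel diff_le_self le_neq_implies_less le_add_diff_inverse Suc_leI)
  define A B where "A = int (s choose Suc q)" and "B = int (s choose q)"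
  have up: "f (Suc s) = A + B" by (simp add: f_def q A_def B_def)
  have down: "int s * f (s - 1) = (int s - int (Suc q)) * A"
  proof (cases "s \<ge> Suc q")
    case True
    have "s * (s - 1 choose Suc q) = (s - Suc q) * (s choose Suc q)"
      using binomial_absorb_comp[of s "Suc q"] by simp
    then have "int s * f (s - 1) = int (s - Suc q) * A"
      by (simp add: f_def q(1) A_def flip: of_nat_mult)
    then show ?thesis using True by (simp add: of_nat_diff)
  qed (simp add: f_def q A_def binomial_eq_0)
  have B: "(int s - int q) * B = (int q + 1) * A"
  proof (cases "s \<ge> q")
    case True
    have "Suc q * (s choose Suc q) = (s - q) * (s choose q)"
      using binomial_absorption[of q s] binomial_absorb_comp[of s q] by simp
    then have "int (Suc q) * A = int (s - q) * B" by (simp only: A_def B_def flip: of_nat_mult)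
    then show ?thesis using True by (simp add: of_nat_diff add.commute)
  qed (simp add: A_def B_def binomial_eq_0)
  have l: "int l = int i + int q + 1" using q by simp
  \<comment> \<open>Write l - s = (i + 1) - (s - q). Used twice, this trades (l - s)^2 B for the
    wanted (i + 1)^2 B and multiples of A.\<close>
  have *: "(int l - int s) * B = (int i + 1) * B - (int q + 1) * A"
    using B unfolding l by (simp add: algebra_simps)
  have "(int l - int s)\<^sup>2 * B = (int l - int s) * ((int l - int s) * B)"
    by (simp add: power2_eq_square mult.assoc)
  also have "\<dots> = (int l - int s) * ((int i + 1) * B - (int q + 1) * A)"
    by (simp only: *)
  also have "\<dots> = (int i + 1) * ((int l - int s) * B) - (int q + 1) * (int l - int s) * A"
    by (simp add: algebra_simps)
  also have "\<dots> = (int i + 1)\<^sup>2 * B - (int i + 1) * (int q + 1) * A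
      - (int q + 1) * (int l - int s) * A"
    unfolding * by (simp add: algebra_simps power2_eq_square)
  finally have sq: "(int l - int s)\<^sup>2 * B = (int i + 1)\<^sup>2 * B - (int i + 1) * (int q + 1) * A
      - (int q + 1) * (int l - int s) * A" .
  have d: "int s * (int m + int s) * f (s - 1) = (int m + int s) * ((int s - int (Suc q)) * A)"
    unfolding down[symmetric] by (simp add: mult_ac)
  have vals: "f s = A" "int (b_value l (Suc i) s) = B" "int (b_value l i s) = A"
    using q i by (simp_all add: f_def A_def B_def b_value_def)
  show ?thesis unfolding vals up distrib_left[of _ A B] sq d
    unfolding l by (simp add: algebra_simps power2_eq_square)
qed

text \<open>The case distinction keeps truncated subtraction from giving C(m + i + j, 0) = 1 for k >
  i + j.\<close>

definition b_const :: "nat \<Rightarrow> nat \<Rightarrow> nat \<Rightarrow> nat \<Rightarrow> nat" where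
  "b_const m i j k = (if k \<le> i + j then (k choose i) * (k choose j) * ((m + i + j) choose (i + j - k)) else 0)"

text \<open>Compare the coefficients of b(k) in (b(1) b(i)) b(j) and b(1) (b(i) b(j)), using b(1)
  b(i) = (i + 1)^2 b(i+1) + i (m + i + 1) b(i).\<close>

lemma b_const_recurrence:
  "(int i + 1)\<^sup>2 * int (b_const m (Suc i) j k) =
    (int k)\<^sup>2 * int (if k = 0 then 0 else b_const m i j (k - 1)) +
    (int k * (int m + int k + 1) - int i * (int m + int i + 1)) * int (b_const m i j k)"
proof (cases k)
  case 0
  then show ?thesis by (cases i) (auto simp: b_const_def)
next
  case (Suc k')
  define A D where "A = int k * int (k' choose i)" and "D = int (k choose j)"
  have absorb: "int k * int (k' choose c) = (int k - int c) * int (k choose c)" for c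
  proof (cases "c \<le> k")
    case True
    have "int ((k - c) * (k choose c)) = int (k * (k' choose c))"
      using binomial_absorb_comp[of k c] by (simp add: Suc)
    then show ?thesis using True by (simp add: of_nat_diff)
  qed (use Suc in \<open>simp add: binomial_eq_0\<close>)
  have A1: "(int i + 1) * int (k choose Suc i) = A"
  proof -
    have "int (Suc i * (k choose Suc i)) = int (k * (k' choose i))"
      by (simp only: Suc Suc_times_binomial)
    then show ?thesis by (simp add: A_def algebra_simps del: binomial_Suc_Suc)
  qed
  have A2: "(int k - int i) * int (k choose i) = A" using absorb by (simp add: A_def)
  have D: "int k * int (k' choose j) = (int k - int j) * D" using absorb by (simp add: D_def)
  have pred: "(if k = 0 then 0 else b_const m i j (k - 1)) = b_const m i j (k - 1)"
    using Suc by simp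
  consider "k \<le> i + j" | "k = Suc (i + j)" | "Suc (i + j) < k" by linarith
  then show ?thesis
  proof cases
    case 1
    define M q where "M = m + i + j" and "q = i + j - k"
    define P Q where "P = int (M choose q)" and "Q = int (M choose Suc q)"
    have Q: "(int q + 1) * Q = (int m + int k) * P"
    proof -
      have "M - q = m + k" using 1 by (simp add: M_def q_def)
      then have "Suc q * (M choose Suc q) = (m + k) * (M choose q)"
        using binomial_absorption[of q M] binomial_absorb_comp[of M q] by simp
      then have "int (Suc q * (M choose Suc q)) = int ((m + k) * (M choose q))"
        by (simp only:)
      then show ?thesis by (simp add: P_def Q_def algebra_simps)
    qed
    have q: "int q = int i + int j - int k" using 1 by (simp add: q_def)
    have "Suc i + j - k = Suc q" "i + j - k' = Suc q" "k' \<le> i + j" using 1 Suc by (simp_all add: q_def)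
    then have "int (b_const m (Suc i) j k) = int (k choose Suc i) * D * (P + Q)"
      "int (b_const m i j (k - 1)) = int (k' choose i) * int (k' choose j) * Q"
      "int (b_const m i j k) = int (k choose i) * D * P"
      using 1 Suc by (simp_all add: b_const_def D_def P_def Q_def M_def q_def del: binomial_Suc_Suc)
        (simp add: algebra_simps)
    note vals = this
    have L: "(int i + 1)\<^sup>2 * (int (k choose Suc i) * D * (P + Q)) = (int i + 1) * A * D * (P + Q)"
      unfolding A1[symmetric] by (simp only: power2_eq_square mult_ac)
    have "(int k)\<^sup>2 * (int (k' choose i) * int (k' choose j) * Q) =
        (int k * int (k' choose i)) * (int k * int (k' choose j)) * Q"
      by (simp only: power2_eq_square mult_ac)
    also have "\<dots> = A * (int k - int j) * D * Q"
      unfolding A_def[symmetric] D by (simp only: mult_ac)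
    finally have R1: "(int k)\<^sup>2 * (int (k' choose i) * int (k' choose j) * Q) = A * (int k - int j) * D * Q" .
    have "(int k * (int m + int k + 1) - int i * (int m + int i + 1)) * (int (k choose i) * D * P) =
        ((int k - int i) * int (k choose i)) * (int m + int k + int i + 1) * D * P"
      by (simp add: algebra_simps)
    also have "\<dots> = A * (int m + int k + int i + 1) * D * P" unfolding A2 ..
    finally have R2: "(int k * (int m + int k + 1) - int i * (int m + int i + 1)) * (int (k choose i) * D * P) =
        A * (int m + int k + int i + 1) * D * P" .
    \<comment> \<open>Both sides now carry the factor A D, and their difference is A D times the
      relation \<open>Q\<close> between neighbouring binomial coefficients.\<close>
    have "(int i + 1) * A * D * (P + Q) - A * (int k - int j) * D * Q - A * (int m + int k + int i + 1) * D * P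
        = A * D * ((int q + 1) * Q - (int m + int k) * P)"
      unfolding q by (simp add: algebra_simps)
    then show ?thesis unfolding pred vals L R1 R2 Q by simp
  next
    case 2
    then have "int (b_const m (Suc i) j k) = int (k choose Suc i) * D"
      "int (b_const m i j (k - 1)) = int (k' choose i) * int (k' choose j)"
      "int (b_const m i j k) = 0" "int k = int i + int j + 1"
      using Suc by (simp_all add: b_const_def D_def del: binomial_Suc_Suc)
    note vals = this
    have "(int i + 1)\<^sup>2 * (int (k choose Suc i) * D) = (int i + 1) * A * D"
      unfolding A1[symmetric] by (simp only: power2_eq_square mult_ac)
    also have "\<dots> = (int k * int (k' choose i)) * ((int k - int j) * D)"
      by (simp add: A_def vals(4))
    also have "\<dots> = (int k)\<^sup>2 * (int (k' choose i) * int (k' choose j))"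
      unfolding D[symmetric] by (simp only: power2_eq_square mult_ac)
    finally show ?thesis unfolding pred vals(1-3) by simp
  next
    case 3
    then show ?thesis using Suc by (simp add: b_const_def)
  qed
qed

section \<open>The multiplication rule for the b(i)\<close>

lemma S_mult_lincomb_left:
  "((\<lambda>x y. c * A x y + d * B x y) \<otimes>\<^bsub>schur_weight_algebra l1 l2\<^esub> C) x y =
    c * (A \<otimes>\<^bsub>schur_weight_algebra l1 l2\<^esub> C) x y + d * (B \<otimes>\<^bsub>schur_weight_algebra l1 l2\<^esub> C) x y"
  for A :: "'k::comm_ring_1 endo"
  unfolding S_mult by (simp add: sum_distrib_left distrib_right sum.distrib mult.assoc)

lemma S_mult_sum_right:
  "A \<otimes>\<^bsub>schur_weight_algebra l1 l2\<^esub> (\<lambda>x y. \<Sum>k\<in>F. c k * B k x y) =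
    (\<lambda>x y. \<Sum>k\<in>F. c k * (A \<otimes>\<^bsub>schur_weight_algebra l1 l2\<^esub> B k) x y)"
  for A :: "'k::comm_ring_1 endo"
proof (intro ext)
  fix x y
  have "(\<Sum>z\<in>tensor_words (l1 + l2). A x z * (\<Sum>k\<in>F. c k * B k z y)) =
      (\<Sum>z\<in>tensor_words (l1 + l2). \<Sum>k\<in>F. c k * (A x z * B k z y))"
    by (simp add: sum_distrib_left mult.left_commute)
  also have "\<dots> = (\<Sum>k\<in>F. \<Sum>z\<in>tensor_words (l1 + l2). c k * (A x z * B k z y))"
    by (rule sum.swap)
  finally show "(A \<otimes>\<^bsub>schur_weight_algebra l1 l2\<^esub> (\<lambda>x y. \<Sum>k\<in>F. c k * B k x y)) x y =
    (\<Sum>k\<in>F. c k * (A \<otimes>\<^bsub>schur_weight_algebra l1 l2\<^esub> B k) x y)"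
    by (simp add: S_mult sum_distrib_left)
qed

lemma b_el_1_mult:
  assumes "l1 = m + l2"
  shows "b_el l1 l2 1 \<otimes>\<^bsub>schur_weight_algebra l1 l2\<^esub> b_el l1 l2 i =
    (\<lambda>x y. (int i + 1)\<^sup>2 * b_el l1 l2 (Suc i) x y + int i * (int m + int i + 1) * b_el l1 l2 i x y)"
proof (intro ext)
  fix x y
  let ?n = "l1 + l2"
  show "(b_el l1 l2 1 \<otimes>\<^bsub>schur_weight_algebra l1 l2\<^esub> b_el l1 l2 i) x y =
    (int i + 1)\<^sup>2 * b_el l1 l2 (Suc i) x y + int i * (int m + int i + 1) * b_el l1 l2 i x y"
  proof (cases "x \<in> weight_words l1 l2 \<and> y \<in> weight_words l1 l2")
    case False
    then show ?thesis by (auto simp: S_mult b_el_eq orbit_endo_def)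
  next
    case True
    let ?Vx = "twos ?n x" and ?Vy = "twos ?n y"
    let ?s = "card (?Vx \<inter> ?Vy)"
    have c: "card ?Vx = l2" "card ?Vy = l2" using True by (simp_all add: weight_words_def)
    have s: "?s \<le> l2" using card_mono[of ?Vx "?Vx \<inter> ?Vy"] c by simp
    have L: "(b_el l1 l2 1 \<otimes>\<^bsub>schur_weight_algebra l1 l2\<^esub> b_el l1 l2 i) x y =
        (\<Sum>Z\<in>{Z. Z \<subseteq> {..<?n} \<and> card Z = l2}.
          int (b_value l2 1 (card (?Vx \<inter> Z))) * int (b_value l2 i (card (Z \<inter> ?Vy))))"
      using True by (simp only: b_el_eq orbit_endo_mult of_nat_id)
    have R: "(int i + 1)\<^sup>2 * b_el l1 l2 (Suc i) x y + int i * (int m + int i + 1) * b_el l1 l2 i x y =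
        (int i + 1)\<^sup>2 * int (b_value l2 (Suc i) ?s) + int i * (int m + int i + 1) * int (b_value l2 i ?s)"
      using True by (simp add: b_el_eq orbit_endo_def)
    show ?thesis
    proof (cases "0 < l2 \<and> i \<le> l2")
      case True
      define f where "f = (\<lambda>s. int (s choose (l2 - i)))"
      have "(\<Sum>Z\<in>{Z. Z \<subseteq> {..<?n} \<and> card Z = l2}.
          int (b_value l2 1 (card (?Vx \<inter> Z))) * int (b_value l2 i (card (Z \<inter> ?Vy)))) =
        (\<Sum>Z\<in>{Z. Z \<subseteq> {..<?n} \<and> card Z = l2}.
          int (card (?Vx \<inter> Z) choose (l2 - 1)) * f (card (Z \<inter> ?Vy)))"
        using True by (simp add: b_value_def f_def)
      also have "\<dots> = (int ?s * (int l2 - int ?s + 1) + (int l2 - int ?s) * (int m + 1 + int ?s)) * f ?s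
          + int ?s * (int m + int ?s) * f (?s - 1) + (int l2 - int ?s)\<^sup>2 * f (Suc ?s)"
        using True c assms twos_subset[of ?n] by (intro sum_choose_pred) auto
      also have "\<dots> = (int i + 1)\<^sup>2 * int (b_value l2 (Suc i) ?s)
          + int i * (int m + int i + 1) * int (b_value l2 i ?s)"
        unfolding f_def using True s by (intro b_value_recurrence) auto
      finally show ?thesis unfolding L R .
    next
      case False
      then show ?thesis unfolding L R by (cases i) (auto simp: b_value_def)
    qed
  qed
qed

lemma b_const_0: "b_const m 0 j k = (if k = j then 1 else 0)"
  by (auto simp: b_const_def binomial_eq_0)

text \<open>The induction on \<open>i\<close> divides by \<open>(i + 1)\<^sup>2\<close>, so it has to take place over the integers.\<close>

lemma b_el_mult_int:
  assumes "l1 = m + l2"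
  shows "(b_el l1 l2 i \<otimes>\<^bsub>schur_weight_algebra l1 l2\<^esub> b_el l1 l2 j) x y =
    (\<Sum>k\<le>l2. int (b_const m i j k) * b_el l1 l2 k x y)"
proof (induction i arbitrary: x y)
  case 0
  interpret cring "schur_weight_algebra l1 l2 :: int endo ring" by (rule cring_S)
  have "b_el l1 l2 0 \<otimes>\<^bsub>schur_weight_algebra l1 l2\<^esub> b_el l1 l2 j = (b_el l1 l2 j :: int endo)"
    using l_one[OF b_el_in_S] by (simp add: b_el_0 S_one)
  moreover have "(\<Sum>k\<le>l2. int (b_const m 0 j k) * b_el l1 l2 k x y) =
      (\<Sum>k\<le>l2. if k = j then b_el l1 l2 k x y else 0)"
    by (intro sum.cong) (simp_all add: b_const_0)
  ultimately show ?case by (simp add: b_el_eq_0)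
next
  case (Suc i)
  let ?S = "schur_weight_algebra l1 l2 :: int endo ring"
  let ?b = "b_el l1 l2 :: nat \<Rightarrow> int endo"
  let ?c = "\<lambda>k. int (b_const m i j k)"
  define e where "e = int i * (int m + int i + 1)"
  have prod: "(?b i \<otimes>\<^bsub>?S\<^esub> ?b j) = (\<lambda>x y. \<Sum>k\<le>l2. ?c k * ?b k x y)"
    by (intro ext) (rule Suc.IH)
  have "(int i + 1)\<^sup>2 * (?b (Suc i) \<otimes>\<^bsub>?S\<^esub> ?b j) x y + e * (?b i \<otimes>\<^bsub>?S\<^esub> ?b j) x y =
      ((?b 1 \<otimes>\<^bsub>?S\<^esub> ?b i) \<otimes>\<^bsub>?S\<^esub> ?b j) x y"
    unfolding b_el_1_mult[OF assms] S_mult_lincomb_left e_def ..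
  also have "\<dots> = (\<Sum>k\<le>l2. ?c k * (?b 1 \<otimes>\<^bsub>?S\<^esub> ?b k) x y)"
    unfolding S_mult_assoc prod S_mult_sum_right ..
  also have "\<dots> = (\<Sum>k\<le>l2. ?c k * ((int k + 1)\<^sup>2 * ?b (Suc k) x y)) +
      (\<Sum>k\<le>l2. ?c k * (int k * (int m + int k + 1) * ?b k x y))"
    unfolding b_el_1_mult[OF assms] by (simp add: distrib_left sum.distrib)
  also have "(\<Sum>k\<le>l2. ?c k * ((int k + 1)\<^sup>2 * ?b (Suc k) x y)) =
      (\<Sum>k\<le>l2. (int k)\<^sup>2 * int (if k = 0 then 0 else b_const m i j (k - 1)) * ?b k x y)"
  proof -
    let ?g = "\<lambda>k. (int k)\<^sup>2 * int (if k = 0 then 0 else b_const m i j (k - 1)) * ?b k x y"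
    have "(\<Sum>k\<le>l2. ?c k * ((int k + 1)\<^sup>2 * ?b (Suc k) x y)) = (\<Sum>k\<le>l2. ?g (Suc k))"
      by (intro sum.cong refl) (simp add: mult_ac add.commute)
    also have "\<dots> = (\<Sum>k\<le>Suc l2. ?g k)" by (subst sum.atMost_Suc_shift) simp
    \<comment> \<open>The top term of the shifted sum drops out because b(l2 + 1) = 0.\<close>
    also have "\<dots> = (\<Sum>k\<le>l2. ?g k)" by (simp add: b_el_eq_0)
    finally show ?thesis .
  qed
  finally have "(int i + 1)\<^sup>2 * (?b (Suc i) \<otimes>\<^bsub>?S\<^esub> ?b j) x y =
      (\<Sum>k\<le>l2. (int k)\<^sup>2 * int (if k = 0 then 0 else b_const m i j (k - 1)) * ?b k x y) +
      (\<Sum>k\<le>l2. ?c k * (int k * (int m + int k + 1) * ?b k x y)) -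
      e * (\<Sum>k\<le>l2. ?c k * ?b k x y)"
    unfolding prod by linarith
  also have "\<dots> = (\<Sum>k\<le>l2. ((int k)\<^sup>2 * int (if k = 0 then 0 else b_const m i j (k - 1)) +
      (int k * (int m + int k + 1) - e) * ?c k) * ?b k x y)"
    unfolding sum_distrib_left sum.distrib[symmetric] sum_subtractf[symmetric]
    by (intro sum.cong refl) (simp only: ring_distribs mult_ac)
  also have "\<dots> = (\<Sum>k\<le>l2. (int i + 1)\<^sup>2 * int (b_const m (Suc i) j k) * ?b k x y)"
    unfolding e_def b_const_recurrence ..
  also have "\<dots> = (int i + 1)\<^sup>2 * (\<Sum>k\<le>l2. int (b_const m (Suc i) j k) * ?b k x y)"
    by (simp add: sum_distrib_left mult.assoc)
  finally show ?case by simp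
qed

text \<open>The matrices over K are images of the integral ones, so the integral formula carries
  over. The range changes from \<open>k \<le> l2\<close> to \<open>k \<le> i + j\<close>, since b(k)
  = 0 beyond the first bound and the constants vanish beyond the second.\<close>

lemma b_el_mult:
  assumes "l1 = m + l2"
  shows "b_el l1 l2 i \<otimes>\<^bsub>schur_weight_algebra l1 l2\<^esub> b_el l1 l2 j =
    (\<lambda>x y. \<Sum>k\<le>i + j. of_nat (b_const m i j k) * b_el l1 l2 k x y :: 'k::comm_ring_1)"
proof (intro ext)
  fix x y
  have hom: "b_el l1 l2 k x y = (of_int (b_el l1 l2 k x y) :: 'k)" for k x y
    by (simp add: b_el_eq orbit_endo_def)
  have "(b_el l1 l2 i \<otimes>\<^bsub>schur_weight_algebra l1 l2\<^esub> b_el l1 l2 j) x y =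
      (of_int ((b_el l1 l2 i \<otimes>\<^bsub>schur_weight_algebra l1 l2\<^esub> b_el l1 l2 j) x y) :: 'k)"
    unfolding S_mult of_int_sum of_int_mult by (simp only: hom[symmetric])
  also have "\<dots> = (\<Sum>k\<le>l2. of_nat (b_const m i j k) * b_el l1 l2 k x y)"
    unfolding b_el_mult_int[OF assms] of_int_sum of_int_mult by (simp only: hom[symmetric] of_int_of_nat_eq)
  also have "\<dots> = (\<Sum>k\<in>{..l2} \<inter> {..i + j}. of_nat (b_const m i j k) * b_el l1 l2 k x y)"
    by (intro sum.mono_neutral_right) (auto simp: b_const_def)
  also have "\<dots> = (\<Sum>k\<le>i + j. of_nat (b_const m i j k) * b_el l1 l2 k x y)"
  proof (intro sum.mono_neutral_left ballI)
    fix k assume "k \<in> {..i + j} - {..l2} \<inter> {..i + j}"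
    then have "l2 < k" by auto
    then show "of_nat (b_const m i j k) * b_el l1 l2 k x y = (0 :: 'k)" by (simp add: b_el_eq_0)
  qed auto
  finally show "(b_el l1 l2 i \<otimes>\<^bsub>schur_weight_algebra l1 l2\<^esub> b_el l1 l2 j) x y =
    (\<Sum>k\<le>i + j. of_nat (b_const m i j k) * b_el l1 l2 k x y :: 'k)" .
qed

subsection \<open>Spanning and independence\<close>

text \<open>The matrix of the C(s, j) is triangular with ones on the diagonal, so the coefficients
  can be chosen one after another without division.\<close>

lemma newton_expansion:
  fixes \<phi> :: "nat \<Rightarrow> 'k::comm_ring_1"
  shows "\<exists>d. \<forall>s\<le>N. \<phi> s = (\<Sum>j\<le>N. d j * of_nat (s choose j))"
proof (induction N)
  case 0
  then show ?case by (intro exI[of _ \<phi>]) simp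
next
  case (Suc N)
  then obtain d where d: "\<And>s. s \<le> N \<Longrightarrow> \<phi> s = (\<Sum>j\<le>N. d j * of_nat (s choose j))" by blast
  define d' where "d' = d(Suc N := \<phi> (Suc N) - (\<Sum>j\<le>N. d j * of_nat (Suc N choose j)))"
  have same: "(\<Sum>j\<le>N. d' j * of_nat (s choose j)) = (\<Sum>j\<le>N. d j * of_nat (s choose j))" for s
    by (intro sum.cong refl) (simp add: d'_def)
  have "\<phi> s = (\<Sum>j\<le>Suc N. d' j * of_nat (s choose j))" if "s \<le> Suc N" for s
  proof (cases "s = Suc N")
    case True
    then show ?thesis unfolding sum.atMost_Suc same by (simp add: d'_def del: binomial_Suc_Suc)
  next
    case False
    then have "s \<le> N" using that by simp
    then show ?thesis unfolding sum.atMost_Suc same using d by (simp add: binomial_eq_0)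
  qed
  then show ?case by blast
qed

lemma b_el_span:
  assumes "A \<in> carrier (schur_weight_algebra l1 l2 :: 'k::comm_ring_1 endo ring)"
  obtains c where "A = (\<lambda>x y. \<Sum>k<Suc l2. c k * b_el l1 l2 k x y)"
proof -
  obtain \<phi> where A: "A = orbit_endo l1 l2 \<phi>" using assms unfolding carrier_S by blast
  obtain d where d: "\<And>s. s \<le> l2 \<Longrightarrow> \<phi> s = (\<Sum>j\<le>l2. d j * of_nat (s choose j))"
    using newton_expansion[of l2 \<phi>] by blast
  have "A x y = (\<Sum>k<Suc l2. d (l2 - k) * b_el l1 l2 k x y)" for x y
  proof (cases "x \<in> weight_words l1 l2 \<and> y \<in> weight_words l1 l2")
    case True
    let ?s = "card (twos (l1 + l2) x \<inter> twos (l1 + l2) y)"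
    have "?s \<le> l2"
      using True card_mono[of "twos (l1 + l2) x" "twos (l1 + l2) x \<inter> twos (l1 + l2) y"]
      by (simp add: weight_words_def)
    then have "A x y = (\<Sum>j\<le>l2. d j * of_nat (?s choose j))"
      using True by (simp add: A orbit_endo_def d)
    also have "\<dots> = (\<Sum>k<Suc l2. d (l2 - k) * of_nat (?s choose (l2 - k)))"
      by (rule sum.reindex_bij_witness[of _ "\<lambda>k. l2 - k" "\<lambda>k. l2 - k"]) auto
    finally show ?thesis using True by (simp add: b_el_eq orbit_endo_def b_value_def)
  next
    case False
    then have "A x y = 0" "b_el l1 l2 k x y = (0 :: 'k)" for k
      by (auto simp: A b_el_eq orbit_endo_def)
    then show ?thesis by simp
  qed
  then show thesis by (intro that[of "\<lambda>k. d (l2 - k)"] ext)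
qed

text \<open>For the largest relevant index t with nonzero coefficient, take words whose sets of twos
  meet in l2 - t points, which exist as \<open>l2 \<le> l1\<close>. There b(k) has entry C(l2 - t,
  l2 - k), which is zero for k < t and one for k = t.\<close>

lemma b_el_independent:
  fixes c :: "nat \<Rightarrow> 'k::comm_ring_1"
  assumes le: "l2 \<le> l1" and zero: "\<And>x y. (\<Sum>k\<in>F. c k * b_el l1 l2 k x y) = 0"
    and F: "finite F" "g \<in> F" "g \<le> l2"
  shows "c g = 0"
proof (rule ccontr)
  assume g: "c g \<noteq> 0"
  define K where "K = {k \<in> F. k \<le> l2 \<and> c k \<noteq> 0}"
  define t where "t = Max K"
  have K: "finite K" "K \<noteq> {}" using F g by (auto simp: K_def)
  then have t: "t \<in> F" "t \<le> l2" "c t \<noteq> 0" using Max_in[OF K] by (auto simp: t_def K_def)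
  have max: "k \<le> t" if "k \<in> F" "k \<le> l2" "c k \<noteq> 0" for k
    using Max_ge[OF K(1)] that by (auto simp: t_def K_def)
  have ex: "\<exists>x\<in>weight_words l1 l2. twos (l1 + l2) x = Z" if "Z \<subseteq> {..<l1 + l2}" "card Z = l2" for Z
  proof -
    have "Z \<in> twos (l1 + l2) ` weight_words l1 l2"
      unfolding bij_betw_imp_surj_on[OF bij_betw_twos_weight] using that by simp
    then show ?thesis by auto
  qed
  obtain x where x: "x \<in> weight_words l1 l2" "twos (l1 + l2) x = {..<l2}"
    using ex[of "{..<l2}"] by auto
  obtain y where y: "y \<in> weight_words l1 l2" "twos (l1 + l2) y = {t..<t + l2}"
  proof -
    have "{t..<t + l2} \<subseteq> {..<l1 + l2}" using t le by auto
    then show thesis using that ex[of "{t..<t + l2}"] by auto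
  qed
  have "{..<l2} \<inter> {t..<t + l2} = {t..<l2}" by auto
  then have val: "b_el l1 l2 k x y = (of_nat (b_value l2 k (l2 - t)) :: 'k)" for k
    using x y by (simp add: b_el_eq orbit_endo_def)
  have "c k * b_el l1 l2 k x y = (if k = t then c t else 0)" if "k \<in> F" for k
  proof (cases "k = t")
    case True
    then show ?thesis using t by (simp add: val b_value_def)
  next
    case False
    show ?thesis
    proof (cases "k \<le> l2 \<and> c k \<noteq> 0")
      case True
      then have "k < t" using max[OF that] False by auto
      then show ?thesis using True t False by (simp add: val b_value_def binomial_eq_0)
    qed (use False in \<open>auto simp: val b_value_def\<close>)
  qed
  then have "(\<Sum>k\<in>F. c k * b_el l1 l2 k x y) = (\<Sum>k\<in>F. if k = t then c t else 0)"
    by (intro sum.cong refl)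
  then show False using zero t F by simp
qed

section \<open>Characteristic two\<close>

context char2_tower
begin

lemma idem_eq_finprod:
  "idem g u = (\<Otimes>v\<in>{v. v < u \<and> bit g v}. a v) \<otimes>
    (\<Otimes>v\<in>{v. v < u \<and> \<not> bit g v \<and> bit (m + g) v}. \<one> \<ominus> a v)"
proof (induction u)
  case (Suc u)
  let ?J = "\<lambda>u. {v. v < u \<and> bit g v}" and ?I = "\<lambda>u. {v. v < u \<and> \<not> bit g v \<and> bit (m + g) v}"
  have J: "?J (Suc u) = (if bit g u then insert u (?J u) else ?J u)"
    and I: "?I (Suc u) = (if \<not> bit g u \<and> bit (m + g) u then insert u (?I u) else ?I u)"
    by (auto simp: less_Suc_eq)
  show ?case unfolding J I by (simp add: Suc factor_def m_ac)
qed simp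

lemma square_add:
  assumes "x \<in> carrier R" "y \<in> carrier R"
  shows "(x \<oplus> y) \<otimes> (x \<oplus> y) = x \<otimes> x \<oplus> y \<otimes> y"
  using assms by (simp add: l_distr r_distr m_comm[of y x] a_assoc)

end

section \<open>Structure constants modulo two\<close>

lemma of_nat_char2:
  assumes "CHAR('k::comm_ring_1) = 2"
  shows "(of_nat n :: 'k) = (if odd n then 1 else 0)"
proof -
  have "(2 :: 'k) = 0" using of_nat_CHAR[where 'a = 'k] assms by simp
  then show ?thesis by (cases "odd n") (auto elim!: evenE oddE)
qed

text \<open>If C(k, 2^u) is odd then k = 2^u + s with s at most t, and C(2^u + s, t) has the parity
  of C(s, t), which forces s = t.\<close>

lemma odd_b_const_disjoint:
  assumes "t < 2 ^ u" "k \<le> 2 ^ u + t"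
  shows "odd (b_const m (2 ^ u) t k) \<longleftrightarrow> k = 2 ^ u + t"
proof
  assume "odd (b_const m (2 ^ u) t k)"
  then have k: "odd (k choose 2 ^ u)" "odd (k choose t)" by (auto simp: b_const_def split: if_splits)
  then have "2 ^ u \<le> k" by (metis binomial_eq_0 even_zero not_le)
  then obtain s where s: "k = 2 ^ u + s" by (auto simp: le_iff_add)
  then have "s \<le> t" "odd (s choose t)"
    using assms k odd_choose_power_add_left[of s u t] by auto
  then show "k = 2 ^ u + t" using s by (metis binomial_eq_0 even_zero le_neq_implies_less)
next
  assume "k = 2 ^ u + t"
  then show "odd (b_const m (2 ^ u) t k)"
    using assms odd_choose_power_right[of k u] odd_choose_power_add_left[of t u t] bit_power_add[of t u u]
    by (simp add: b_const_def)
qed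

text \<open>C(2^u + t, 2^u) is odd, and the remaining factor C(m + 2^(u+1), 2^u - t) has the parity
  of C(m, 2^u - t).\<close>

lemma odd_b_const_square:
  assumes "t < 2 ^ u"
  shows "odd (b_const m (2 ^ u) (2 ^ u) (2 ^ u + t)) \<longleftrightarrow> odd (m choose (2 ^ u - t))"
proof -
  have "odd ((2 ^ u + t) choose 2 ^ u)"
    using assms by (simp add: odd_choose_power_right bit_power_add)
  moreover have "m + 2 ^ Suc u = m + 2 ^ u + 2 ^ u" "2 ^ u + 2 ^ u - (2 ^ u + t) = 2 ^ u - t" by simp_all
  moreover have "2 ^ u + t \<le> 2 ^ u + 2 ^ u" using assms by simp
  ultimately show ?thesis
    using odd_choose_add_double_power[of "2 ^ u - t" u m, unfolded \<open>m + 2 ^ Suc u = m + 2 ^ u + 2 ^ u\<close>] unfolding b_const_def by simp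
qed

lemma sum_lessThan_add:
  fixes f :: "nat \<Rightarrow> 'a::comm_monoid_add"
  shows "(\<Sum>t<n + k. f t) = (\<Sum>t<n. f t) + (\<Sum>t<k. f (n + t))"
  by (induction k) (simp_all add: add.assoc)

lemma sum_lessThan_power_Suc:
  fixes f :: "nat \<Rightarrow> 'a::comm_monoid_add"
  shows "(\<Sum>t<2 ^ Suc u. f t) = (\<Sum>t<2 ^ u. f t) + (\<Sum>t<2 ^ u. f (2 ^ u + t))"
  using sum_lessThan_add[of f "2 ^ u" "2 ^ u"] by (simp add: mult_2)

locale schur_char2 =
  fixes ty :: "'k::field itself" and l1 l2 m :: nat
  assumes char2: "CHAR('k) = 2" and l1: "l1 = m + l2"
begin

abbreviation S where "S \<equiv> schur_weight_algebra l1 l2 :: 'k endo ring"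
abbreviation b where "b \<equiv> b_el l1 l2 :: nat \<Rightarrow> 'k endo"

sublocale cring S by (rule cring_S)

lemma b_closed [simp]: "b k \<in> carrier S"
  by (rule b_el_in_S)

lemma b_0: "b 0 = \<one>\<^bsub>S\<^esub>"
  by (simp add: b_el_0 S_one)

lemma b_power_mult:
  assumes "t < 2 ^ u" shows "b (2 ^ u) \<otimes>\<^bsub>S\<^esub> b t = b (2 ^ u + t)"
proof (intro ext)
  fix x y
  have "(b (2 ^ u) \<otimes>\<^bsub>S\<^esub> b t) x y = (\<Sum>k\<le>2 ^ u + t. if k = 2 ^ u + t then b k x y else 0)"
    unfolding b_el_mult[OF l1]
    by (intro sum.cong refl) (simp add: of_nat_char2[OF char2] odd_b_const_disjoint[OF assms])
  then show "(b (2 ^ u) \<otimes>\<^bsub>S\<^esub> b t) x y = b (2 ^ u + t) x y" by simp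
qed

lemma b_power_square:
  "b (2 ^ u) \<otimes>\<^bsub>S\<^esub> b (2 ^ u) = (\<lambda>x y. \<Sum>t<2 ^ u. of_nat (m choose (2 ^ u - t)) * b (2 ^ u + t) x y)"
proof (intro ext)
  fix x y
  let ?f = "\<lambda>k. of_nat (b_const m (2 ^ u) (2 ^ u) k) * b k x y"
  have "(b (2 ^ u) \<otimes>\<^bsub>S\<^esub> b (2 ^ u)) x y = (\<Sum>k\<le>2 ^ u + 2 ^ u. ?f k)"
    unfolding b_el_mult[OF l1] ..
  also have "\<dots> = (\<Sum>k\<in>(+) (2 ^ u) ` {..<2 ^ u}. ?f k)"
  proof (intro sum.mono_neutral_right ballI)
    fix k :: nat assume k: "k \<in> {..2 ^ u + 2 ^ u} - (+) (2 ^ u) ` {..<2 ^ u}"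
    \<comment> \<open>Up to 2^(u+1), the numbers with digit \<open>u\<close> are exactly those from
      2^u to 2^(u+1) - 1; the end point 2^(u+1) is among those that lack it.\<close>
    have "\<not> bit k u"
    proof (cases "k < 2 ^ u")
      case True
      then show ?thesis using bit_less_power by blast
    next
      case False
      then have "k = 2 ^ u + (k - 2 ^ u)" by simp
      then have "\<not> k - 2 ^ u < 2 ^ u" using k by blast
      then have "k = 2 ^ Suc u" using k by auto
      then show ?thesis by (simp only: bit_exp_iff) simp
    qed
    then have "even (b_const m (2 ^ u) (2 ^ u) k)"
      using odd_choose_power_right[of k u] by (simp add: b_const_def)
    then show "?f k = 0" by (simp add: of_nat_char2[OF char2])
  qed auto
  also have "\<dots> = (\<Sum>t<2 ^ u. ?f (2 ^ u + t))"
    by (subst sum.reindex) (simp_all add: comp_def)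
  also have "\<dots> = (\<Sum>t<2 ^ u. of_nat (m choose (2 ^ u - t)) * b (2 ^ u + t) x y)"
    by (intro sum.cong refl) (simp add: of_nat_char2[OF char2] odd_b_const_square)
  finally show "(b (2 ^ u) \<otimes>\<^bsub>S\<^esub> b (2 ^ u)) x y =
      (\<Sum>t<2 ^ u. of_nat (m choose (2 ^ u - t)) * b (2 ^ u + t) x y)" .
qed

lemma add_self_field: "x + x = (0 :: 'k)"
proof -
  have "(of_nat 2 :: 'k) = 0" by (simp add: of_nat_char2[OF char2])
  then show ?thesis by (metis mult_2 mult_zero_left of_nat_numeral)
qed

text \<open>Split the sum for u+1 at 2^u. The upper half is a_u p_u. In the lower half C(m, 2^(u+1)
  - t) has the parity of m_u C(m, 2^u - t) for t > 0 and of m_(u+1) for t = 0, whence the scalar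
  correction in the recursion.\<close>

lemma tower_coeff_eq:
  "tower_coeff S m (\<lambda>u. b (2 ^ u)) u = (\<lambda>x y. \<Sum>t<2 ^ u. of_nat (m choose (2 ^ u - t)) * b t x y)"
proof (induction u)
  case 0
  show ?case
    by (intro ext) (simp add: b_0 of_nat_char2[OF char2] S_zero bit_0)
next
  case (Suc u)
  let ?p = "tower_coeff S m (\<lambda>u. b (2 ^ u))"
  let ?c = "\<lambda>t. of_nat (m choose (2 ^ u - t)) :: 'k"
  have p [simp]: "?p v \<in> carrier S" for v by (induction v) auto
  have ap: "b (2 ^ u) \<otimes>\<^bsub>S\<^esub> ?p u = (\<lambda>x y. \<Sum>t<2 ^ u. ?c t * b (2 ^ u + t) x y)"
    unfolding Suc.IH S_mult_sum_right
    by (intro ext sum.cong refl) (simp add: b_power_mult)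
  show ?case
  proof (intro ext)
    fix x y
    have "?p (Suc u) x y = (if bit m (Suc u) = bit m u then 0 else b 0 x y) +
        ((if bit m u then ?p u x y else 0) + (b (2 ^ u) \<otimes>\<^bsub>S\<^esub> ?p u) x y)"
      using l_distr[of "if bit m u then \<one>\<^bsub>S\<^esub> else \<zero>\<^bsub>S\<^esub>" "b (2 ^ u)" "?p u"]
      by (simp add: b_0) (simp add: S_add S_zero)
    moreover have "(\<Sum>t<2 ^ u. of_nat (m choose (2 ^ Suc u - t)) * b t x y) =
        (if bit m (Suc u) = bit m u then 0 else b 0 x y) + (if bit m u then ?p u x y else 0)"
    proof -
      have c: "(of_nat (m choose (2 ^ Suc u - t)) :: 'k) * b t x y = (if bit m u then ?c t * b t x y else 0) +
          (if t = 0 then (if bit m (Suc u) = bit m u then 0 else b 0 x y) else 0)" if "t < 2 ^ u" for t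
      proof (cases "t = 0")
        case True
        then have "odd (m choose (2 ^ Suc u - t)) = bit m (Suc u)" "odd (m choose (2 ^ u - t)) = bit m u"
          using odd_choose_power_right[of m u] odd_choose_power_right[of m "Suc u"]
          by (simp_all del: power_Suc)
        then show ?thesis using True
          by (cases "bit m u"; cases "bit m (Suc u)")
            (simp_all add: of_nat_char2[OF char2] add_self_field del: power_Suc)
      next
        case False
        then have "2 ^ Suc u - t = 2 ^ u + (2 ^ u - t)" "2 ^ u - t < 2 ^ u" using that by auto
        then have "odd (m choose (2 ^ Suc u - t)) \<longleftrightarrow> bit m u \<and> odd (m choose (2 ^ u - t))"
          by (metis odd_choose_power_add_right)
        then show ?thesis using False by (simp add: of_nat_char2[OF char2])
      qed
      have "(\<Sum>t<2 ^ u. of_nat (m choose (2 ^ Suc u - t)) * b t x y) =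
          (\<Sum>t<2 ^ u. if bit m u then ?c t * b t x y else 0) +
          (\<Sum>t<(2::nat) ^ u. if t = 0 then (if bit m (Suc u) = bit m u then 0 else b 0 x y) else 0)"
        unfolding sum.distrib[symmetric] by (intro sum.cong refl c) simp
      also have "(\<Sum>t<2 ^ u. if bit m u then ?c t * b t x y else 0) = (if bit m u then ?p u x y else 0)"
        unfolding Suc.IH by simp
      also have "(\<Sum>t<(2::nat) ^ u. if t = 0 then (if bit m (Suc u) = bit m u then 0 else b 0 x y) else 0) =
          (if bit m (Suc u) = bit m u then 0 else b 0 x y)"
        by (simp add: sum.delta)
      finally show ?thesis by (simp only: add.commute)
    qed
    moreover have "(\<Sum>t<2 ^ Suc u. of_nat (m choose (2 ^ Suc u - t)) * b t x y) =
        (\<Sum>t<2 ^ u. of_nat (m choose (2 ^ Suc u - t)) * b t x y) + (b (2 ^ u) \<otimes>\<^bsub>S\<^esub> ?p u) x y"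
      unfolding sum_lessThan_power_Suc ap by simp
    ultimately show "?p (Suc u) x y = (\<Sum>t<2 ^ Suc u. of_nat (m choose (2 ^ Suc u - t)) * b t x y)"
      by (simp only: add.assoc)
  qed
qed

text \<open>Multiplying the explicit sum for p_u by b(2^u) turns each b(t) into b(2^u + t), which
  gives the formula for b(2^u)^2.\<close>

sublocale char2_tower S "\<lambda>u. b (2 ^ u)" m
proof unfold_locales
  show "\<one>\<^bsub>S\<^esub> \<oplus>\<^bsub>S\<^esub> \<one>\<^bsub>S\<^esub> = \<zero>\<^bsub>S\<^esub>" by (simp add: S_add S_zero add_self_field)
  show "b (2 ^ u) \<otimes>\<^bsub>S\<^esub> b (2 ^ u) = b (2 ^ u) \<otimes>\<^bsub>S\<^esub> tower_coeff S m (\<lambda>u. b (2 ^ u)) u" for u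
    unfolding tower_coeff_eq S_mult_sum_right b_power_square
    by (intro ext sum.cong refl) (simp add: b_power_mult)
qed simp

text \<open>Multiplication by b(2^u) shifts the indices below 2^u by 2^u, so a factor a_u moves the
  leading index from g mod 2^u to 2^u + (g mod 2^u), while the factors 1 - a_u and 1 keep
  it.\<close>

lemma idem_expansion:
  "\<exists>c. idem g u = (\<lambda>x y. \<Sum>k<2 ^ u. c k * b k x y) \<and> c (g mod 2 ^ u) = 1 \<and> (\<forall>k<g mod 2 ^ u. c k = 0)"
proof (induction u)
  case 0
  show ?case by (rule exI[of _ "\<lambda>_. 1"]) (simp add: b_0)
next
  case (Suc u)
  then obtain c where c: "idem g u = (\<lambda>x y. \<Sum>k<2 ^ u. c k * b k x y)" "c (g mod 2 ^ u) = 1"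
    "\<And>k. k < g mod 2 ^ u \<Longrightarrow> c k = 0" by blast
  let ?r = "g mod 2 ^ u"
  have r: "?r < 2 ^ u" by simp
  have gr: "g mod 2 ^ Suc u = (if bit g u then 2 ^ u + ?r else ?r)"
    by (simp add: mod_mult2_eq bit_iff_odd mod_2_eq_odd power_Suc2 del: power_Suc)
  have shift: "idem g u \<otimes>\<^bsub>S\<^esub> b (2 ^ u) = (\<lambda>x y. \<Sum>k<2 ^ u. c k * b (2 ^ u + k) x y)"
    unfolding m_comm[OF idem_closed b_closed] unfolding c(1) S_mult_sum_right
    by (intro ext sum.cong refl) (simp add: b_power_mult)
  have split: "(\<Sum>k<2 ^ Suc u. h k * b k x y) =
      (\<Sum>k<2 ^ u. h k * b k x y) + (\<Sum>k<2 ^ u. h (2 ^ u + k) * b (2 ^ u + k) x y)" for h x y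
    by (rule sum_lessThan_power_Suc)
  define h where "h k = (if k < 2 ^ u then if bit g u then 0 else c k
    else if bit g u \<or> bit (m + g) u then c (k - 2 ^ u) else 0)" for k
  have "idem g (Suc u) x y = (\<Sum>k<2 ^ Suc u. h k * b k x y)" for x y
  proof -
    have e: "idem g (Suc u) = (if bit g u then idem g u \<otimes>\<^bsub>S\<^esub> b (2 ^ u)
        else if bit (m + g) u then idem g u \<oplus>\<^bsub>S\<^esub> idem g u \<otimes>\<^bsub>S\<^esub> b (2 ^ u) else idem g u)"
      by (simp add: factor_def minus_eq_add r_distr)
    have v: "idem g u x y = (\<Sum>k<2 ^ u. c k * b k x y)" by (simp only: c(1))
    have sh: "(idem g u \<otimes>\<^bsub>S\<^esub> b (2 ^ u)) x y = (\<Sum>k<2 ^ u. c k * b (2 ^ u + k) x y)"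
      by (simp only: shift)
    show ?thesis unfolding split e
      by (cases "bit g u"; cases "bit (m + g) u") (simp_all add: h_def v sh S_add)
  qed
  moreover have "h (g mod 2 ^ Suc u) = 1" unfolding gr using c(2) r by (simp add: h_def)
  moreover have "h k = 0" if "k < g mod 2 ^ Suc u" for k
  proof -
    have "k < (if bit g u then 2 ^ u + ?r else ?r)" using that unfolding gr .
    then show ?thesis using c(3)[of k] c(3)[of "k - 2 ^ u"] less_trans[OF _ r, of k]
      by (cases "bit g u") (auto simp: h_def)
  qed
  ultimately show ?case by (intro exI[of _ h] conjI ext allI impI)
qed

text \<open>The expansion begins at b(g), and b(k) = 0 for k > l2. These are the indices with m + 2g
  > r.\<close>

lemma idem_eq_zero:
  assumes "l2 < g" "g < 2 ^ u" shows "idem g u = \<zero>\<^bsub>S\<^esub>"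
proof -
  obtain c where c: "idem g u = (\<lambda>x y. \<Sum>k<2 ^ u. c k * b k x y)" "\<forall>k<g. c k = 0"
    using idem_expansion[of g u] assms by auto
  have "c k * b k x y = 0" for k x y
    using c(2) assms by (cases "k < g") (simp_all add: b_el_eq_0)
  then show ?thesis unfolding c(1) S_zero by (intro ext sum.neutral ballI)
qed

lemma idem_neq_zero:
  assumes "g \<le> l2" "g < 2 ^ u" shows "idem g u \<noteq> \<zero>\<^bsub>S\<^esub>"
proof
  assume 0: "idem g u = \<zero>\<^bsub>S\<^esub>"
  obtain c where c: "idem g u = (\<lambda>x y. \<Sum>k<2 ^ u. c k * b k x y)" "c g = 1"
    using idem_expansion[of g u] assms by auto
  have "c g = 0"
  proof (rule b_el_independent)
    show "(\<Sum>k<2 ^ u. c k * b_el l1 l2 k x y) = 0" for x y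
      using 0 by (simp add: c(1) S_zero) meson
  qed (use assms l1 in auto)
  then show False using c by simp
qed

text \<open>An idempotent \<open>E = idem g u\<close> either absorbs \<open>b(k)\<^sup>2\<close> or annihilates it; as squaring is additive, \<open>E x\<^sup>2\<close> is
  a scalar multiple of \<open>E\<close> for every \<open>x\<close>.\<close>

lemma idem_mult_b_square:
  assumes "bits_disjoint m u g" "w \<le> u" "k < 2 ^ w"
  shows "idem g u \<otimes>\<^bsub>S\<^esub> (b k \<otimes>\<^bsub>S\<^esub> b k) \<in> {\<zero>\<^bsub>S\<^esub>, idem g u}"
  using assms(2,3)
proof (induction w arbitrary: k)
  case 0
  then show ?case by (simp add: b_0)
next
  case (Suc w)
  show ?case
  proof (cases "k < 2 ^ w")
    case False
    define t where "t = k - 2 ^ w"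
    have t: "t < 2 ^ w" "k = 2 ^ w + t" using Suc.prems False by (auto simp: t_def)
    have "idem g u \<otimes>\<^bsub>S\<^esub> (b k \<otimes>\<^bsub>S\<^esub> b k) =
        (idem g u \<otimes>\<^bsub>S\<^esub> (b (2 ^ w) \<otimes>\<^bsub>S\<^esub> b (2 ^ w))) \<otimes>\<^bsub>S\<^esub> (b t \<otimes>\<^bsub>S\<^esub> b t)"
      unfolding t(2) b_power_mult[OF t(1), symmetric] by (simp add: m_ac)
    moreover have "idem g u \<otimes>\<^bsub>S\<^esub> (b (2 ^ w) \<otimes>\<^bsub>S\<^esub> b (2 ^ w)) \<in> {\<zero>\<^bsub>S\<^esub>, idem g u}"
      using idem_mult_a_square[OF assms(1)] Suc.prems by simp
    ultimately show ?thesis using Suc.IH[of t] Suc.prems t by auto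
  qed (use Suc in simp)
qed

section \<open>Squares cut by an idempotent, and primitivity\<close>

lemma scale_closed:
  assumes "A \<in> carrier S" shows "(\<lambda>x y. c * A x y) \<in> carrier S"
proof -
  obtain \<phi> where "A = orbit_endo l1 l2 \<phi>" using assms unfolding carrier_S by blast
  then have "(\<lambda>x y. c * A x y) = orbit_endo l1 l2 (\<lambda>s. c * \<phi> s)"
    by (intro ext) (simp add: orbit_endo_def)
  then show ?thesis by (simp add: carrier_S)
qed

lemma idem_mult_square:
  assumes "bits_disjoint m u g" "l2 < 2 ^ u" "A \<in> carrier S"
  shows "\<exists>d. idem g u \<otimes>\<^bsub>S\<^esub> (A \<otimes>\<^bsub>S\<^esub> A) = (\<lambda>x y. d * idem g u x y)"
proof -
  obtain c where A: "A = (\<lambda>x y. \<Sum>k<Suc l2. c k * b k x y)" using b_el_span[OF assms(3)] .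
  define P where "P n = (\<lambda>x y. \<Sum>k<n. c k * b k x y)" for n
  have P_Suc: "P (Suc n) = P n \<oplus>\<^bsub>S\<^esub> (\<lambda>x y. c n * b n x y)" for n
    by (simp add: P_def S_add)
  have P [simp]: "P n \<in> carrier S" for n
  proof (induction n)
    case 0
    have "P 0 = \<zero>\<^bsub>S\<^esub>" by (simp add: P_def S_zero)
    then show ?case by simp
  qed (simp add: P_Suc scale_closed)
  have "n \<le> Suc l2 \<Longrightarrow> \<exists>d. idem g u \<otimes>\<^bsub>S\<^esub> (P n \<otimes>\<^bsub>S\<^esub> P n) = (\<lambda>x y. d * idem g u x y)" for n
  proof (induction n)
    case 0
    have "P 0 = \<zero>\<^bsub>S\<^esub>" by (simp add: P_def S_zero)
    then have "idem g u \<otimes>\<^bsub>S\<^esub> (P 0 \<otimes>\<^bsub>S\<^esub> P 0) = \<zero>\<^bsub>S\<^esub>" by simp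
    then show ?case by (intro exI[of _ 0]) (simp add: S_zero)
  next
    case (Suc n)
    then obtain d where d: "idem g u \<otimes>\<^bsub>S\<^esub> (P n \<otimes>\<^bsub>S\<^esub> P n) = (\<lambda>x y. d * idem g u x y)" by auto
    let ?B = "\<lambda>x y. c n * b n x y"
    have B: "?B \<in> carrier S" by (rule scale_closed) simp
    have "?B \<otimes>\<^bsub>S\<^esub> ?B = (\<lambda>x y. (c n)\<^sup>2 * (b n \<otimes>\<^bsub>S\<^esub> b n) x y)"
      by (simp add: S_mult sum_distrib_left power2_eq_square mult_ac)
    then have "idem g u \<otimes>\<^bsub>S\<^esub> (?B \<otimes>\<^bsub>S\<^esub> ?B) = (\<lambda>x y. (c n)\<^sup>2 * (idem g u \<otimes>\<^bsub>S\<^esub> (b n \<otimes>\<^bsub>S\<^esub> b n)) x y)"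
      by (simp add: S_mult sum_distrib_left mult_ac)
    moreover have "idem g u \<otimes>\<^bsub>S\<^esub> (b n \<otimes>\<^bsub>S\<^esub> b n) \<in> {\<zero>\<^bsub>S\<^esub>, idem g u}"
      by (rule idem_mult_b_square[OF assms(1) order_refl]) (use Suc.prems assms in simp)
    ultimately obtain e where e: "idem g u \<otimes>\<^bsub>S\<^esub> (?B \<otimes>\<^bsub>S\<^esub> ?B) = (\<lambda>x y. e * idem g u x y)"
      by (force simp: S_zero)
    have "idem g u \<otimes>\<^bsub>S\<^esub> (P (Suc n) \<otimes>\<^bsub>S\<^esub> P (Suc n)) =
        idem g u \<otimes>\<^bsub>S\<^esub> (P n \<otimes>\<^bsub>S\<^esub> P n) \<oplus>\<^bsub>S\<^esub> idem g u \<otimes>\<^bsub>S\<^esub> (?B \<otimes>\<^bsub>S\<^esub> ?B)"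
      unfolding P_Suc square_add[OF P B] by (simp add: r_distr B)
    then show ?case unfolding d e by (intro exI[of _ "d + e"]) (simp add: S_add distrib_right)
  qed
  from this[of "Suc l2"] show ?thesis unfolding P_def A by simp
qed

text \<open>A summand A in an orthogonal decomposition of E satisfies E A^2 = A, hence A = d E for a
  scalar d. Idempotency gives d^2 = d, so d is 0 or 1.\<close>

lemma idem_primitive:
  assumes disj: "bits_disjoint m u g" and g: "g \<le> l2" "l2 < 2 ^ u"
  shows "primitive_idempotent S (idem g u)"
  unfolding primitive_idempotent_def
proof (intro conjI allI impI)
  let ?E = "idem g u"
  show "is_idempotent S ?E" by (simp add: is_idempotent_def idem_step(1)[OF disj])
  show nz: "?E \<noteq> \<zero>\<^bsub>S\<^esub>" using g by (intro idem_neq_zero) auto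
  fix A B assume A: "is_idempotent S A" and B: "is_idempotent S B"
    and "A \<otimes>\<^bsub>S\<^esub> B = \<zero>\<^bsub>S\<^esub>" and BA: "B \<otimes>\<^bsub>S\<^esub> A = \<zero>\<^bsub>S\<^esub>" and E: "?E = A \<oplus>\<^bsub>S\<^esub> B"
  have c: "A \<in> carrier S" "B \<in> carrier S" and AA: "A \<otimes>\<^bsub>S\<^esub> A = A"
    using A B by (auto simp: is_idempotent_def)
  have "?E \<otimes>\<^bsub>S\<^esub> (A \<otimes>\<^bsub>S\<^esub> A) = A" unfolding AA E using c AA BA by (simp add: l_distr)
  then obtain d where d: "A = (\<lambda>x y. d * ?E x y)"
    using idem_mult_square[OF disj g(2) c(1)] by auto
  have "A \<otimes>\<^bsub>S\<^esub> A = (\<lambda>x y. d * (d * (?E \<otimes>\<^bsub>S\<^esub> ?E) x y))"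
    unfolding d by (simp add: S_mult sum_distrib_left mult_ac)
  then have dd: "d * (d * ?E x y) = d * ?E x y" for x y
    using AA unfolding idem_step(1)[OF disj] d by metis
  obtain x y where "?E x y \<noteq> 0" using nz unfolding S_zero fun_eq_iff by blast
  then have "d = 0 \<or> d = 1" using dd[of x y] by simp
  then show "A = \<zero>\<^bsub>S\<^esub> \<or> B = \<zero>\<^bsub>S\<^esub>"
  proof
    assume "d = 1"
    then have "A = ?E" using d by simp
    then have "A \<oplus>\<^bsub>S\<^esub> B = A" unfolding E[symmetric] by (rule sym)
    then have "A x y + B x y = A x y" for x y unfolding S_add by (rule fun_cong[THEN fun_cong])
    then have "B = \<zero>\<^bsub>S\<^esub>" unfolding S_zero by (intro ext) simp
    then show ?thesis ..
  qed (simp add: d S_zero)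
qed

text \<open>The digits of m + 2g = g + (m + g) are the disjoint union of those of g and of m + g, so
  J_(m,g) is the first set and I_(m,g) the second; all of them lie below \<open>u\<close>.\<close>

lemma e_el_eq_idem:
  assumes "odd ((m + 2 * g) choose g)" "m + g < 2 ^ u"
  shows "e_el l1 l2 m g = idem g u"
proof -
  have eq: "m + 2 * g = g + (m + g)" by simp
  have disj: "\<forall>v. \<not> (bit g v \<and> bit (m + g) v)"
    using assms(1) unfolding eq odd_choose_add_iff_disjoint .
  have less: "bit g v \<Longrightarrow> v < u" "bit (m + g) v \<Longrightarrow> v < u" for v
    using bit_less_power[of g v u] bit_less_power[of "m + g" v u] assms(2) by auto
  have "J_set m g = {v. v < u \<and> bit g v}" "I_set m g = {v. v < u \<and> \<not> bit g v \<and> bit (m + g) v}"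
    unfolding J_set_def I_set_def eq bit_add_disjoint[OF disj] using less disj by auto
  then show ?thesis by (simp add: e_el_def idem_eq_finprod Let_def)
qed

end

section \<open>The complete set of primitive orthogonal idempotents, read off at depth u = r\<close>

theorem mainTheorem1:
  fixes r m l1 l2 :: nat
  assumes "CHAR('k::field) = 2"
    and "l2 \<le> l1" and "l1 + l2 = r" and "l1 - l2 = m"
  shows "complete_primitive_orthogonal_idempotents
           (schur_weight_algebra l1 l2 :: 'k endo ring)
           {e_el l1 l2 m g | g. odd ((m + 2 * g) choose g) \<and> m + 2 * g \<le> r}"
proof -
  have l1: "l1 = m + l2" and r: "r = m + 2 * l2" using assms by auto
  interpret schur_char2 "TYPE('k)" l1 l2 m by unfold_locales (use assms l1 in auto)
  \<comment> \<open>Since m + g is at most r, depth \<open>r\<close> covers all binary digits of g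
    and m + g.\<close>
  have small: "m + g < 2 ^ r" if "g \<le> l2" for g
    using less_exp[of r] that r by linarith
  let ?G = "{g. g < 2 ^ r \<and> bits_disjoint m r g}"
  define G where "G = {g. odd ((m + 2 * g) choose g) \<and> m + 2 * g \<le> r}"
  have G: "G = {g \<in> ?G. g \<le> l2}"
  proof -
    have "odd ((m + 2 * g) choose g) \<longleftrightarrow> g < 2 ^ r \<and> bits_disjoint m r g" if "g \<le> l2" for g
    proof -
      have eq: "m + 2 * g = g + (m + g)" by simp
      have less: "v < r" if "bit g v" for v
        using that bit_less_power[of g v r] small[OF \<open>g \<le> l2\<close>] by simp
      have "odd ((m + 2 * g) choose g) \<longleftrightarrow> (\<forall>v. \<not> (bit g v \<and> bit (m + g) v))"
        unfolding eq odd_choose_add_iff_disjoint ..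
      then show ?thesis using less small[OF that] by (auto simp: bits_disjoint_def)
    qed
    then show ?thesis by (auto simp: G_def r)
  qed
  have finG: "finite ?G" by simp
  have sub: "G \<subseteq> ?G" and G_le: "\<And>g. g \<in> G \<Longrightarrow> g \<le> l2"
    and disj: "\<And>g. g \<in> G \<Longrightarrow> bits_disjoint m r g" using G by auto
  have l2: "l2 < 2 ^ r" using small[of l2] by simp
  have orth: "idem g r \<otimes>\<^bsub>S\<^esub> idem h r = \<zero>\<^bsub>S\<^esub>" if "g \<in> G" "h \<in> G" "g \<noteq> h" for g h
    using that G by (intro idem_orthogonal) auto
  \<comment> \<open>The sum runs over a set of elements, so distinct indices must give distinct
    elements; equal ones would be orthogonal to themselves, hence zero.\<close>
  have inj: "inj_on (\<lambda>g. idem g r) G"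
  proof (rule inj_onI, rule ccontr)
    fix g h assume gh: "g \<in> G" "h \<in> G" "idem g r = idem h r" "g \<noteq> h"
    have "idem g r = \<zero>\<^bsub>S\<^esub>"
      using orth[OF gh(1,2,4)] idem_step(1)[OF disj[OF gh(1)]] gh(3) by simp
    then show False using idem_neq_zero[of g r] G_le[OF gh(1)] l2 by simp
  qed
  have "{e_el l1 l2 m g | g. odd ((m + 2 * g) choose g) \<and> m + 2 * g \<le> r} = e_el l1 l2 m ` G"
    by (auto simp: G_def)
  also have "\<dots> = (\<lambda>g. idem g r) ` G"
    using e_el_eq_idem small G_le by (intro image_cong refl) (auto simp: G_def)
  finally have A: "{e_el l1 l2 m g | g. odd ((m + 2 * g) choose g) \<and> m + 2 * g \<le> r} = (\<lambda>g. idem g r) ` G" .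
  have "(\<Oplus>\<^bsub>S\<^esub>A\<in>(\<lambda>g. idem g r) ` G. A) = (\<Oplus>\<^bsub>S\<^esub>g\<in>G. idem g r)"
    using inj by (intro finsum_reindex) auto
  \<comment> \<open>The indices below 2^r with g > l2 contribute zero and complete the sum to that
    of \<open>idem_sum\<close>.\<close>
  also have "\<dots> = (\<Oplus>\<^bsub>S\<^esub>g\<in>?G. idem g r)"
    using sub finG G by (intro add.finprod_mono_neutral_cong_left) (auto intro: idem_eq_zero)
  also have "\<dots> = \<one>\<^bsub>S\<^esub>" by (rule idem_sum)
  finally have sum: "(\<Oplus>\<^bsub>S\<^esub>A\<in>(\<lambda>g. idem g r) ` G. A) = \<one>\<^bsub>S\<^esub>" .
  show ?thesis
    unfolding complete_primitive_orthogonal_idempotents_def A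
  proof (intro conjI ballI impI)
    show "finite ((\<lambda>g. idem g r) ` G)" using finite_subset[OF sub finG] by simp
    show "primitive_idempotent S E" if "E \<in> (\<lambda>g. idem g r) ` G" for E
      using that idem_primitive[OF disj G_le l2] by auto
    show "E \<otimes>\<^bsub>S\<^esub> F = \<zero>\<^bsub>S\<^esub>" if "E \<in> (\<lambda>g. idem g r) ` G" "F \<in> (\<lambda>g. idem g r) ` G" "E \<noteq> F" for E F
      using that orth by auto
  qed (rule sum)
qed

end
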